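(* Let $W$ be an irreducible finite complex reflection group with reflection representation $V\cong\mathbb{C}^N$ and reflection arrangement $\mathcal{A}$, and let $m\colon\mathcal{A}\to\mathbb{N}$ be a $W$-invariant multiplicity function such that $m_H\ge1$ for all $H\in\mathcal{A}$. Let $\mathcal{D}=\partial_{y_N}$ be K. Saito's primitive derivation. Then $\mathcal{D}(Q_m)\subseteq Q_{m-1}$.
   Context: $\mathbb{N}=\{0,1,2,\dots\}$. $SV^*=\mathbb{C}[x_1,\dots,x_N]$ where $x_1,\dots,x_N$ is a basis of $V^*$; $W$ acts on it by $(wf)(x)=f(w^{-1}x)$. $\mathcal{A}$ is the set of reflection hyperplanes; for $H\in\mathcal{A}$, $\alpha_H\in V^*$ satisfies $H=\ker\alpha_H$, $W_H$ is the (cyclic) pointwise stabiliser of $H$ in $W$, $n_H=|W_H|$, $m_H=m(H)$. Quasi-invariants: put $e_{H,i}=\sum_{w\in W_H}(\det w)^iw\in\mathbb{C}W_H$ for $1\le i\le n_H-1$ (determinant taken on $V$). $Q_m$ is the set of $p\in SV^*$ such that $e_{H,i}(p)$ is divisible by $\alpha_H^{m_Hn_H}$ for all $H\in\mathcal{A}$, $1\le i\le n_H-1$. $Q_{m-1}$ is the same space for the multiplicity function $H\mapsto m_H-1$. Primitive derivation: let $y_1,\dots,y_N\in(SV^* )^W$ be homogeneous basic invariants (algebraically independent generators of $(SV^* )^W$) with $\deg y_1\le\dots\le\deg y_N$. $\mathcal{D}=\partial_{y_N}$ is the derivation of the field $\mathbb{C}(x_1,\dots,x_N)$ determined by $\mathcal{D}(y_i)=\delta_{iN}$,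 $1\le i\le N$. *)

theory Defs
  imports
    "HOL-Analysis.Analysis"
    "HOL-Algebra.Generated_Groups"
    "HOL-Library.Poly_Mapping"
    "HOL-Computational_Algebra.Polynomial_Factorial"
begin

text \<open>
  The finite linearly ordered index type \<open>'n\<close> plays the role of \<open>{1 < \<dots> < N}\<close>; the order is used
  to list basic invariants by increasing degree, and by the library instance that makes
  multivariate polynomials an integral domain.
  The reflection representation is \<open>V = complex ^ 'n\<close> and \<open>SV\<^sup>*\<close> is the ring of (formal) polynomials in the coordinates of \<open>V\<close>.
\<close>

type_synonym 'n cvec = "(complex, 'n) vec"
type_synonym 'n cmat = "((complex, 'n) vec, 'n) vec"
type_synonym 'n mpoly = "('n \<Rightarrow>\<^sub>0 nat) \<Rightarrow>\<^sub>0 complex"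

definition Const :: "complex \<Rightarrow> 'n mpoly" where
  "Const c = Poly_Mapping.single 0 c"

definition Var :: "'n \<Rightarrow> 'n mpoly" where
  "Var i = Poly_Mapping.single (Poly_Mapping.single i 1) 1"

definition poly_eval :: "'n::finite cvec \<Rightarrow> 'n mpoly \<Rightarrow> complex" where
  "poly_eval v p =
     (\<Sum>k\<in>Poly_Mapping.keys p. Poly_Mapping.lookup p k * (\<Prod>i\<in>UNIV. (v $ i) ^ Poly_Mapping.lookup k i))"

definition poly_subst :: "('n::finite \<Rightarrow> 'n mpoly) \<Rightarrow> 'n mpoly \<Rightarrow> 'n mpoly" where
  "poly_subst f p =
     (\<Sum>k\<in>Poly_Mapping.keys p. Const (Poly_Mapping.lookup p k) * (\<Prod>i\<in>UNIV. f i ^ Poly_Mapping.lookup k i))"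

definition homogeneous :: "nat \<Rightarrow> 'n::finite mpoly \<Rightarrow> bool" where
  "homogeneous d p \<longleftrightarrow> (\<forall>k\<in>Poly_Mapping.keys p. (\<Sum>i\<in>UNIV. Poly_Mapping.lookup k i) = d)"


definition GL :: "'n::finite cmat monoid" where
  "GL = \<lparr>carrier = {A. invertible A}, monoid.mult = (**), one = mat 1\<rparr>"

lemma group_GL: "group (GL :: 'n::finite cmat monoid)"
proof (rule groupI)
  fix A :: "'n cmat"
  assume "A \<in> carrier GL"
  then obtain B where "A ** B = mat 1" "B ** A = mat 1"
    by (auto simp: GL_def invertible_def)
  then show "\<exists>B\<in>carrier GL. B \<otimes>\<^bsub>GL\<^esub> A = \<one>\<^bsub>GL\<^esub>"
    by (auto simp: GL_def invertible_def)
qed (auto simp: GL_def invertible_mult matrix_mul_assoc invertible_def[of "mat 1"])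

definition fixed_space :: "'n cmat \<Rightarrow> 'n::finite cvec set" where
  "fixed_space w = {v. w *v v = v}"

text \<open>
  In a finite group all elements have finite order, so the complex reflections in \<open>W\<close> are
  exactly the elements whose fixed space is a hyperplane.
\<close>

definition reflections :: "'n::finite cmat set \<Rightarrow> 'n cmat set" where
  "reflections W = {s\<in>W. vec.dim (fixed_space s) = CARD('n) - 1}"

definition finite_complex_reflection_group :: "'n::finite cmat set \<Rightarrow> bool" where
  "finite_complex_reflection_group W \<longleftrightarrow>
     finite W \<and> subgroup W GL \<and> generate GL (reflections W) = W"

definition irreducible_action :: "'n::finite cmat set \<Rightarrow> bool" where
  "irreducible_action W \<longleftrightarrow>
     (\<forall>U. vec.subspace U \<and> (\<forall>w\<in>W. \<forall>u\<in>U. w *v u \<in> U) \<longrightarrow> U = {0} \<or> U = UNIV)"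

definition arrangement :: "'n::finite cmat set \<Rightarrow> 'n cvec set set" where
  "arrangement W = fixed_space ` reflections W"

definition pointwise_stabiliser ::
    "'n::finite cmat set \<Rightarrow> 'n cvec set \<Rightarrow> 'n cmat set" where
  "pointwise_stabiliser W H = {w\<in>W. \<forall>v\<in>H. w *v v = v}"

text \<open>Elements of \<open>V\<^sup>*\<close> are viewed inside \<open>SV\<^sup>*\<close> as the homogeneous polynomials of degree 1.\<close>

definition defining_form :: "'n::finite cvec set \<Rightarrow> 'n mpoly \<Rightarrow> bool" where
  "defining_form H a \<longleftrightarrow> homogeneous 1 a \<and> {v. poly_eval v a = 0} = H"


text \<open>
  \<open>act w f\<close> is the polynomial \<open>x \<mapsto> f (w\<^sup>-\<^sup>1 x)\<close>, obtained by substituting for each coordinate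
  the corresponding coordinate of \<open>w\<^sup>-\<^sup>1 x\<close>; see \<open>poly_eval_act\<close>.
\<close>

definition act :: "'n cmat \<Rightarrow> 'n::finite mpoly \<Rightarrow> 'n mpoly" where
  "act w f = poly_subst (\<lambda>i. \<Sum>j\<in>UNIV. Const (matrix_inv w $ i $ j) * Var j) f"

definition invariants :: "'n::finite cmat set \<Rightarrow> 'n mpoly set" where
  "invariants W = {f. \<forall>w\<in>W. act w f = f}"

definition e_op ::
    "'n::finite cmat set \<Rightarrow> 'n cvec set \<Rightarrow> nat \<Rightarrow> 'n mpoly \<Rightarrow> 'n mpoly" where
  "e_op W H i p = (\<Sum>w\<in>pointwise_stabiliser W H. Const (det w ^ i) * act w p)"

text \<open>\<open>\<alpha> H\<close> is the chosen linear form \<open>\<alpha>\<^sub>H\<close>.\<close>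

definition quasi_invariants ::
    "'n::finite cmat set \<Rightarrow> ('n cvec set \<Rightarrow> 'n mpoly) \<Rightarrow>
     ('n cvec set \<Rightarrow> nat) \<Rightarrow> 'n mpoly set" where
  "quasi_invariants W \<alpha> m =
     {p. \<forall>H\<in>arrangement W. \<forall>i\<in>{1..card (pointwise_stabiliser W H) - 1}.
           \<alpha> H ^ (m H * card (pointwise_stabiliser W H)) dvd e_op W H i p}"


text \<open>
  \<open>y\<close> is indexed by \<open>'n\<close>, so a polynomial in \<open>y\<^sub>1, \<dots>, y\<^sub>N\<close> is \<open>poly_subst y P\<close>.
\<close>

definition basic_invariants ::
    "'n::{finite,linorder} cmat set \<Rightarrow> ('n \<Rightarrow> 'n mpoly) \<Rightarrow> bool" where
  "basic_invariants W y \<longleftrightarrow>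
     (\<forall>i. y i \<in> invariants W) \<and>
     (\<forall>f\<in>invariants W. \<exists>P. f = poly_subst y P) \<and>
     (\<forall>P. poly_subst y P = 0 \<longrightarrow> P = 0) \<and>
     (\<exists>d. mono d \<and> (\<forall>i. homogeneous (d i) (y i)))"

definition derivation :: "('n::{finite,linorder} mpoly fract \<Rightarrow> 'n mpoly fract) \<Rightarrow> bool" where
  "derivation D \<longleftrightarrow>
     (\<forall>a b. D (a + b) = D a + D b) \<and>
     (\<forall>c a. D (to_fract (Const c) * a) = to_fract (Const c) * D a) \<and>
     (\<forall>a b. D (a * b) = a * D b + D a * b)"

text \<open>
  For basic invariants \<open>y\<close> this predicate determines \<open>D\<close> uniquely, since the field of rational
  functions is a finite separable extension of the field generated by \<open>y\<close>.
\<close>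

definition primitive_derivation ::
    "('n::{finite,linorder} \<Rightarrow> 'n mpoly) \<Rightarrow> ('n mpoly fract \<Rightarrow> 'n mpoly fract) \<Rightarrow> bool" where
  "primitive_derivation y D \<longleftrightarrow>
     derivation D \<and> (\<forall>i. D (to_fract (y i)) = (if i = Max UNIV then 1 else 0))"


lemma mpoly_induct [case_names single sum]:
  fixes p :: "'n mpoly"
  assumes single: "\<And>k c. P (Poly_Mapping.single k c)"
    and sum: "\<And>p q. P p \<Longrightarrow> P q \<Longrightarrow> P (p + q)"
  shows "P p"
proof (induction p rule: Poly_Mapping.update_induct)
  case const
  then show ?case using single[of 0 0] by simp
next
  case (update p k c)
  then have "Poly_Mapping.update k c p = Poly_Mapping.single k c + p"
    by (intro poly_mapping_eqI)
      (auto simp: Poly_Mapping.lookup_update lookup_add lookup_single in_keys_iff when_def)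
  then show ?case using update single sum by simp
qed

lemma poly_eval_superset:
  assumes "finite S" "Poly_Mapping.keys p \<subseteq> S"
  shows "poly_eval v p =
    (\<Sum>k\<in>S. Poly_Mapping.lookup p k * (\<Prod>i\<in>UNIV. (v $ i) ^ Poly_Mapping.lookup k i))"
  unfolding poly_eval_def
  by (rule sum.mono_neutral_left) (use assms in \<open>auto simp: in_keys_iff\<close>)

lemma poly_eval_add: "poly_eval v (p + q) = poly_eval v p + poly_eval v q"
proof -
  let ?S = "Poly_Mapping.keys p \<union> Poly_Mapping.keys q"
  have "Poly_Mapping.keys (p + q) \<subseteq> ?S" by (rule Poly_Mapping.keys_add)
  then show ?thesis
    by (simp add: poly_eval_superset[of ?S] lookup_add ring_distribs sum.distrib)
qed

lemma poly_eval_zero [simp]: "poly_eval v 0 = 0"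
  by (simp add: poly_eval_def)

lemma poly_eval_sum: "poly_eval v (sum f A) = (\<Sum>a\<in>A. poly_eval v (f a))"
  by (induction A rule: infinite_finite_induct) (simp_all add: poly_eval_add)

lemma poly_eval_single:
  "poly_eval v (Poly_Mapping.single k c) = c * (\<Prod>i\<in>UNIV. (v $ i) ^ Poly_Mapping.lookup k i)"
  by (simp add: poly_eval_def)

lemma poly_eval_mult: "poly_eval v (p * q) = poly_eval v p * poly_eval v q"
proof -
  have single: "poly_eval v (Poly_Mapping.single k c * q) = poly_eval v (Poly_Mapping.single k c) * poly_eval v q"
    for k c and q
  proof (induction q rule: mpoly_induct)
    case (single l d)
    show ?case
      by (simp add: mult_single poly_eval_single lookup_add power_add prod.distrib)
  next
    case (sum f g)
    then show ?case
      by (simp add: ring_distribs poly_eval_add)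
  qed
  show ?thesis
    by (induction p rule: mpoly_induct) (simp_all add: single ring_distribs poly_eval_add)
qed

lemma poly_eval_Const [simp]: "poly_eval v (Const c) = c"
  by (simp add: Const_def poly_eval_single)

lemma poly_eval_one [simp]: "poly_eval v 1 = 1"
  using poly_eval_Const[of v 1] by (simp add: Const_def)

lemma poly_eval_Var [simp]: "poly_eval v (Var i) = v $ i"
proof -
  have "(\<Prod>j\<in>UNIV. (v $ j) ^ (1 when i = j)) = (\<Prod>j\<in>UNIV. if i = j then v $ j else 1)"
    by (rule prod.cong) (auto simp: when_def)
  then show ?thesis
    by (simp add: Var_def poly_eval_single lookup_single)
qed

lemma poly_eval_power: "poly_eval v (p ^ n) = poly_eval v p ^ n"
  by (induction n) (simp_all add: poly_eval_mult)

lemma poly_eval_prod: "poly_eval v (prod f A) = (\<Prod>a\<in>A. poly_eval v (f a))"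
  by (induction A rule: infinite_finite_induct) (simp_all add: poly_eval_mult)

lemma poly_eval_poly_subst: "poly_eval v (poly_subst f p) = poly_eval (\<chi> i. poly_eval v (f i)) p"
  by (simp add: poly_subst_def poly_eval_sum poly_eval_mult poly_eval_prod poly_eval_power
      poly_eval_def[of "\<chi> i. poly_eval v (f i)"])

lemma poly_eval_act: "poly_eval v (act w f) = poly_eval (matrix_inv w *v v) f"
  by (simp add: act_def poly_eval_poly_subst poly_eval_sum poly_eval_mult matrix_vector_mult_def)

end

theory Submission
  imports Defs
begin

text \<open>
  A linear form \<open>u\<close> is a root of the monic polynomial \<open>\<Prod>\<^sub>w (T - w u)\<close> over the invariants, and \<open>D\<close>
  preserves the invariants. Differentiating this equation shows that \<open>D\<close> is \<open>W\<close>-equivariant and that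
  \<open>D u\<close> has denominator \<open>\<Prod>\<^sub>w (u - w u)\<close>, the product being over \<open>w \<noteq> 1\<close>. For generic \<open>u\<close> exactly
  \<open>n\<^sub>H - 1\<close> of these factors are proportional to \<open>\<alpha>\<^sub>H\<close>, so \<open>D\<close> maps polynomials to fractions with poles of
  order at most \<open>n\<^sub>H - 1\<close> along \<open>H\<close>; no Jacobian is needed.

  Now \<open>n\<^sub>H p = \<Sum>\<^sub>i e\<^sub>H\<^sub>,\<^sub>i p\<close> with \<open>0 \<le> i < n\<^sub>H\<close>. For \<open>i \<ge> 1\<close> the Leibniz rule loses at most \<open>n\<^sub>H\<close> powers of
  \<open>\<alpha>\<^sub>H\<close>. For \<open>i = 0\<close> the term is \<open>W\<^sub>H\<close>-invariant, and so is its image, whose order along \<open>H\<close> is then a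
  multiple of \<open>n\<^sub>H\<close> and hence not negative. So \<open>D p\<close> is a polynomial, and \<open>D\<close> commutes with \<open>e\<^sub>H\<^sub>,\<^sub>i\<close>.
\<close>

section \<open>Polynomials as functions and as expressions\<close>

text \<open>As with independence of characters: monomials are multiplicative under the
  coordinatewise product of vectors, so one term of a relation can be eliminated and induction
  applies.\<close>

lemma monomial_functions_independent:
  fixes c :: "('n::finite \<Rightarrow>\<^sub>0 nat) \<Rightarrow> complex"
  assumes "finite S"
    and "\<And>v :: 'n cvec. (\<Sum>k\<in>S. c k * (\<Prod>i\<in>UNIV. (v $ i) ^ Poly_Mapping.lookup k i)) = 0"
    and "k \<in> S"
  shows "c k = 0"
  using assms
proof (induction S arbitrary: c k rule: finite_induct)
  case empty
  then show ?case by simp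
next
  case (insert k0 S)
  define X where "X k v = (\<Prod>i\<in>UNIV. (v $ i) ^ Poly_Mapping.lookup k i)"
    for k :: "'n \<Rightarrow>\<^sub>0 nat" and v :: "'n cvec"
  have X_mult: "X k (\<chi> i. u $ i * v $ i) = X k u * X k v" for k u v
    by (simp add: X_def power_mult_distrib prod.distrib)
  have zero: "c k0 * X k0 v + (\<Sum>k\<in>S. c k * X k v) = 0" for v
    using insert.prems(1)[of v] insert.hyps by (simp add: X_def)
  have S_eq: "(\<Sum>k\<in>S. c k * X k v) = - (c k0 * X k0 v)" for v
    using zero[of v] by (metis minus_unique)
  \<comment> \<open>The relation at the coordinatewise product of \<open>u\<close> and
    \<open>v\<close>, minus \<open>X k0 u\<close> times the relation at \<open>v\<close>, has no
    \<open>k0\<close> term.\<close>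
  have "(\<Sum>k\<in>S. c k * (X k u - X k0 u) * X k v) = 0" for u v
  proof -
    have "(\<Sum>k\<in>S. c k * (X k u - X k0 u) * X k v)
        = (\<Sum>k\<in>S. c k * X k (\<chi> i. u $ i * v $ i)) - X k0 u * (\<Sum>k\<in>S. c k * X k v)"
      by (simp add: X_mult sum_distrib_left sum_subtractf[symmetric] algebra_simps)
    also have "\<dots> = - (c k0 * X k0 (\<chi> i. u $ i * v $ i)) - X k0 u * (- (c k0 * X k0 v))"
      by (simp only: S_eq)
    also have "\<dots> = 0" by (simp add: X_mult)
    finally show ?thesis .
  qed
  then have S0: "c k * (X k u - X k0 u) = 0" if "k \<in> S" for k u
    using insert.IH[of "\<lambda>k. c k * (X k u - X k0 u)" k] that by (simp add: X_def)
  have cS: "c k = 0" if "k \<in> S" for k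
  proof -
    have "k \<noteq> k0" using that insert.hyps by auto
    then obtain i where i: "Poly_Mapping.lookup k i \<noteq> Poly_Mapping.lookup k0 i"
      by (meson poly_mapping_eqI)
    \<comment> \<open>This point turns a monomial into the power of 2 given by its exponent at
      \<open>i\<close>, which separates \<open>k\<close> from \<open>k0\<close>.\<close>
    define u :: "'n cvec" where "u = (\<chi> j. if j = i then 2 else 1)"
    have "X l u = 2 ^ Poly_Mapping.lookup l i" for l
    proof -
      have "X l u = (\<Prod>j\<in>UNIV. if j = i then 2 ^ Poly_Mapping.lookup l i else 1)"
        unfolding X_def u_def by (rule prod.cong) auto
      then show ?thesis by simp
    qed
    moreover have "(2::complex) ^ a \<noteq> 2 ^ b" if "a \<noteq> b" for a b :: nat
      using that by (metis of_nat_eq_iff of_nat_numeral of_nat_power power_inject_exp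
          one_less_numeral_iff semiring_norm(76))
    ultimately show ?thesis using S0[OF that, of u] i by simp
  qed
  have "c k0 = 0"
    using zero[of "\<chi> i. 1"] cS by (simp add: X_def)
  with cS insert.prems(2) show ?case by auto
qed

lemma poly_eval_eq_0D:
  assumes "\<And>v. poly_eval v p = 0"
  shows "p = 0"
proof (rule ccontr)
  assume "p \<noteq> 0"
  then obtain k where "k \<in> Poly_Mapping.keys p"
    by (metis keys_eq_empty ex_in_conv)
  moreover from this have "Poly_Mapping.lookup p k = 0"
    using monomial_functions_independent[of "Poly_Mapping.keys p" "Poly_Mapping.lookup p" k] assms
    by (simp add: poly_eval_def)
  ultimately show False by (simp add: in_keys_iff)
qed

lemma poly_eval_uminus [simp]: "poly_eval v (- p) = - poly_eval v p"
  using poly_eval_add[of v p "- p"] by (simp add: add_eq_0_iff)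

lemma poly_eval_diff [simp]: "poly_eval v (p - q) = poly_eval v p - poly_eval v q"
  using poly_eval_add[of v p "- q"] by simp

lemmas poly_eval_simps [simp] =
  poly_eval_add poly_eval_mult poly_eval_sum poly_eval_prod poly_eval_power
  poly_eval_poly_subst poly_eval_act

text \<open>Reduces identities of polynomials to identities of their values, which is how the laws
  of substitution and of the action are obtained.\<close>

lemma poly_eval_eqI:
  assumes "\<And>v. poly_eval v p = poly_eval v q"
  shows "p = q"
  using poly_eval_eq_0D[of "p - q"] assms by simp

lemma Const_0 [simp]: "Const 0 = 0" and Const_1 [simp]: "Const 1 = 1"
  by (simp_all add: Const_def)

lemma Const_mult: "(Const (a * b) :: 'n::finite mpoly) = Const a * Const b"
  by (rule poly_eval_eqI) simp

lemma mpoly_ring_induct [case_names Const Var add mult]: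
  fixes p :: "'n::finite mpoly"
  assumes Const: "\<And>c. P (Const c)" and Var: "\<And>i. P (Var i)"
    and add: "\<And>p q. P p \<Longrightarrow> P q \<Longrightarrow> P (p + q)"
    and mult: "\<And>p q. P p \<Longrightarrow> P q \<Longrightarrow> P (p * q)"
  shows "P p"
proof (induction p rule: mpoly_induct)
  case (single k c)
  have "P 1" using Const[of 1] by simp
  then have power: "P (Var i ^ n)" for i n
    by (induction n) (auto intro: mult Var)
  have "P (\<Prod>i\<in>A. Var i ^ Poly_Mapping.lookup k i)" for A
    by (induction A rule: infinite_finite_induct) (auto intro: mult power \<open>P 1\<close>)
  moreover have "Poly_Mapping.single k c = Const c * (\<Prod>i\<in>UNIV. Var i ^ Poly_Mapping.lookup k i)"
    by (rule poly_eval_eqI) (simp add: poly_eval_single)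
  ultimately show ?case by (simp add: mult Const)
qed (rule add)

lemma poly_subst_add: "poly_subst f (p + q) = poly_subst f p + poly_subst f q"
  and poly_subst_mult: "poly_subst f (p * q) = poly_subst f p * poly_subst f q"
  and poly_subst_Const [simp]: "poly_subst f (Const c) = Const c"
  and poly_subst_Var [simp]: "poly_subst f (Var i) = f i"
  by (rule poly_eval_eqI; simp)+

lemma poly_subst_1 [simp]: "poly_subst f 1 = 1"
  by (rule poly_eval_eqI) simp

section \<open>The group action on polynomials\<close>

lemma act_add: "act w (p + q) = act w p + act w q"
  and act_diff: "act w (p - q) = act w p - act w q"
  and act_mult: "act w (p * q) = act w p * act w q"
  and act_power: "act w (p ^ k) = act w p ^ k"
  and act_sum: "act w (sum f A) = (\<Sum>a\<in>A. act w (f a))"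
  and act_prod: "act w (prod f A) = (\<Prod>a\<in>A. act w (f a))"
  and act_uminus: "act w (- p) = - act w p"
  and act_Const [simp]: "act w (Const c) = Const c"
  and act_0 [simp]: "act w 0 = 0"
  and act_1 [simp]: "act w 1 = 1"
  by (rule poly_eval_eqI; simp)+

lemmas act_simps = act_add act_diff act_mult act_power act_sum act_prod act_uminus

lemma matrix_inv_cancel:
  fixes A :: "'n::finite cmat"
  assumes "invertible A"
  shows "A *v (matrix_inv A *v v) = v" and "matrix_inv A *v (A *v v) = v"
proof -
  have "A ** matrix_inv A = mat 1 \<and> matrix_inv A ** A = mat 1"
    using assms unfolding invertible_def matrix_inv_def by (rule someI_ex)
  then show "A *v (matrix_inv A *v v) = v" "matrix_inv A *v (A *v v) = v"
    by (simp_all add: matrix_vector_mul_assoc)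
qed

lemma act_act:
  fixes w w' :: "'n::finite cmat"
  assumes "invertible w" "invertible w'"
  shows "act w (act w' p) = act (w ** w') p"
proof (rule poly_eval_eqI)
  fix v
  have "invertible (w ** w')" using assms by (rule invertible_mult)
  moreover have "(w ** w') *v (matrix_inv w' *v (matrix_inv w *v v)) = v"
    using assms by (simp add: matrix_vector_mul_assoc[symmetric] matrix_inv_cancel)
  ultimately have "matrix_inv w' *v (matrix_inv w *v v) = matrix_inv (w ** w') *v v"
    using matrix_inv_cancel(2) by metis
  then show "poly_eval v (act w (act w' p)) = poly_eval v (act (w ** w') p)" by simp
qed

lemma invertible_mat_1 [simp]: "invertible (mat 1 :: 'n::finite cmat)"
  by (auto simp: invertible_def)

lemma act_mat_1 [simp]: "act (mat 1) (p :: 'n::finite mpoly) = p"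
proof (rule poly_eval_eqI)
  fix v :: "'n cvec"
  have "matrix_inv (mat 1) *v v = v"
    using matrix_inv_cancel(1)[OF invertible_mat_1, of v] by simp
  then show "poly_eval v (act (mat 1) p) = poly_eval v p" by simp
qed

lemma act_eq_0_iff:
  assumes "invertible w"
  shows "act w p = 0 \<longleftrightarrow> p = 0"
proof
  assume "act w p = 0"
  then have "poly_eval (matrix_inv w *v (w *v v)) p = 0" for v
    using poly_eval_act[of "w *v v" w p] by simp
  then show "p = 0"
    by (intro poly_eval_eq_0D) (simp add: matrix_inv_cancel[OF assms])
qed simp

section \<open>Linear forms\<close>

text \<open>A linear form is encoded by its coefficient vector. The pairing is bilinear without
  conjugation, hence symmetric in form and point.\<close>

definition lin :: "'n::finite cvec \<Rightarrow> 'n mpoly" where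
  "lin a = (\<Sum>i\<in>UNIV. Const (a $ i) * Var i)"

lemma poly_eval_lin: "poly_eval v (lin a) = (\<Sum>i\<in>UNIV. a $ i * v $ i)"
  by (simp add: lin_def)

lemma poly_eval_lin_commute: "poly_eval v (lin a) = poly_eval a (lin v)"
  by (simp add: poly_eval_lin mult.commute)

lemma lin_add: "lin (a + b) = lin a + lin b"
  and lin_diff: "lin (a - b) = lin a - lin b"
  and lin_scale: "lin (c *s a) = Const c * lin a"
  by (rule poly_eval_eqI;
      simp add: poly_eval_lin ring_distribs sum.distrib sum_subtractf sum_distrib_left mult.assoc)+

lemma poly_eval_lin_vec:
  "poly_eval (u + v) (lin a) = poly_eval u (lin a) + poly_eval v (lin a)"
  "poly_eval (u - v) (lin a) = poly_eval u (lin a) - poly_eval v (lin a)"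
  "poly_eval (c *s v) (lin a) = c * poly_eval v (lin a)"
  by (simp_all add: poly_eval_lin_commute[of _ a] lin_add lin_diff lin_scale)

lemma poly_eval_lin_axis: "poly_eval (axis i 1) (lin a) = a $ i"
proof -
  have "poly_eval (axis i 1) (lin a) = (\<Sum>j\<in>UNIV. if j = i then a $ i else 0)"
    unfolding poly_eval_lin by (rule sum.cong) (auto simp: axis_def)
  then show ?thesis by simp
qed

lemma lin_eq_0_iff [simp]: "lin a = 0 \<longleftrightarrow> a = 0"
proof
  assume "lin a = 0"
  then show "a = 0"
    using poly_eval_lin_axis[of _ a] by (simp add: vec_eq_iff)
qed (simp add: lin_def)

lemma Var_eq_lin: "Var i = lin (axis i 1)"
  by (rule poly_eval_eqI) (simp add: poly_eval_lin_commute[of _ "axis i 1"] poly_eval_lin_axis)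

lemma homogeneous_1_lin:
  fixes p :: "'n::finite mpoly"
  assumes "homogeneous 1 p"
  obtains a where "p = lin a"
proof
  have single: "\<exists>i. k = Poly_Mapping.single i 1" if "k \<in> Poly_Mapping.keys p" for k
  proof -
    have sum: "(\<Sum>i\<in>UNIV. Poly_Mapping.lookup k i) = 1"
      using assms that by (simp add: homogeneous_def)
    then obtain i where i: "Poly_Mapping.lookup k i \<noteq> 0"
      by (metis sum.neutral zero_neq_one)
    have eq: "Poly_Mapping.lookup k i + (\<Sum>j\<in>UNIV - {i}. Poly_Mapping.lookup k j) = 1"
      using sum by (simp add: sum.remove[of UNIV i])
    then have "(\<Sum>j\<in>UNIV - {i}. Poly_Mapping.lookup k j) = 0" and "Poly_Mapping.lookup k i = 1"
      using i by linarith+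
    then have "k = Poly_Mapping.single i 1"
      by (intro poly_mapping_eqI) (auto simp: lookup_single when_def)
    then show ?thesis ..
  qed
  define a where "a = (\<chi> i. Poly_Mapping.lookup p (Poly_Mapping.single i 1))"
  have inj: "inj (\<lambda>i::'n. Poly_Mapping.single i (1::nat))"
    by (rule injI) (metis lookup_single_eq lookup_single_not_eq zero_neq_one)
  have keys: "Poly_Mapping.keys p \<subseteq> range (\<lambda>i. Poly_Mapping.single i 1)"
    using single by auto
  show "p = lin a"
  proof (rule poly_eval_eqI)
    fix v :: "'n cvec"
    have mono: "(\<Prod>j\<in>UNIV. (v $ j) ^ Poly_Mapping.lookup (Poly_Mapping.single i 1) j) = v $ i" for i
      using poly_eval_Var[of v i] by (simp add: Var_def poly_eval_single)
    show "poly_eval v p = poly_eval v (lin a)"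
      by (subst poly_eval_superset[OF _ keys])
        (simp_all add: sum.reindex[OF inj, simplified] mono[simplified] poly_eval_lin a_def)
  qed
qed

lemma act_lin: "act w (lin a) = lin (a v* matrix_inv w)"
proof (rule poly_eval_eqI)
  fix v
  have "poly_eval v (act w (lin a)) = (\<Sum>i\<in>UNIV. \<Sum>j\<in>UNIV. a $ i * (matrix_inv w $ i $ j * v $ j))"
    by (simp add: poly_eval_lin matrix_vector_mult_def sum_distrib_left)
  also have "\<dots> = (\<Sum>j\<in>UNIV. \<Sum>i\<in>UNIV. a $ i * (matrix_inv w $ i $ j * v $ j))"
    by (rule sum.swap)
  also have "\<dots> = poly_eval v (lin (a v* matrix_inv w))"
    by (simp add: poly_eval_lin vector_matrix_mult_def sum_distrib_left mult_ac)
  finally show "poly_eval v (act w (lin a)) = poly_eval v (lin (a v* matrix_inv w))" .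
qed

text \<open>For \<open>b $ i \<noteq> 0\<close> the vectors
  \<open>axis j 1 - (b $ j / b $ i) *s axis i 1\<close> lie in the kernel of \<open>lin b\<close>;
  evaluating \<open>lin a\<close> there gives every coordinate of \<open>a\<close>.\<close>

lemma lin_proportional:
  assumes "b \<noteq> 0" and "\<And>v. poly_eval v (lin b) = 0 \<Longrightarrow> poly_eval v (lin a) = 0"
  obtains c where "a = c *s b"
proof -
  obtain i where i: "b $ i \<noteq> 0" using assms(1) by (auto simp: vec_eq_iff)
  have "a $ j = a $ i / b $ i * b $ j" for j
  proof -
    have "poly_eval (axis j 1 - (b $ j / b $ i) *s axis i 1) (lin b) = 0"
      using i by (simp add: poly_eval_lin_vec poly_eval_lin_axis)
    from assms(2)[OF this] show ?thesis
      by (simp add: poly_eval_lin_vec poly_eval_lin_axis)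
  qed
  then have "a = (a $ i / b $ i) *s b"
    by (intro vec_eq_iff[THEN iffD2] allI) (metis vector_smult_component)
  then show ?thesis by (rule that)
qed

text \<open>\<open>\<sigma>\<close> substitutes a linear projection of \<open>V\<close> onto the kernel of \<open>lin b\<close>.\<close>

lemma lin_dvd_iff_subst:
  fixes b :: "'n::finite cvec"
  assumes "b \<noteq> 0"
  obtains \<sigma> where "\<And>p. lin b dvd p \<longleftrightarrow> poly_subst \<sigma> p = 0"
    and "\<And>p. poly_subst \<sigma> p = 0 \<longleftrightarrow> (\<forall>v. poly_eval v (lin b) = 0 \<longrightarrow> poly_eval v p = 0)"
proof -
  obtain i where i: "b $ i \<noteq> 0" using assms by (auto simp: vec_eq_iff)
  define \<sigma> where "\<sigma> j = Var j - (if j = i then Const (1 / b $ i) * lin b else 0)" for j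
  define \<pi> where "\<pi> v = v - (poly_eval v (lin b) / b $ i) *s axis i 1" for v :: "'n cvec"
  have eval: "poly_eval v (poly_subst \<sigma> p) = poly_eval (\<pi> v) p" for v p
  proof -
    have "(\<chi> j. poly_eval v (\<sigma> j)) = \<pi> v"
      by (auto simp: \<sigma>_def \<pi>_def vec_eq_iff axis_def)
    then show ?thesis by simp
  qed
  have \<pi>_ker: "poly_eval (\<pi> v) (lin b) = 0" for v
    using i by (simp add: \<pi>_def poly_eval_lin_vec poly_eval_lin_axis)
  have \<pi>_id: "\<pi> v = v" if "poly_eval v (lin b) = 0" for v
    using that by (simp add: \<pi>_def vec_eq_iff)
  \<comment> \<open>Modulo \<open>lin b\<close> the substitution is the identity on constants and
    variables, hence on all polynomials. So a polynomial that it kills is divisible by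
    \<open>lin b\<close>.\<close>
  have cong: "lin b dvd p - poly_subst \<sigma> p" for p
  proof (induction p rule: mpoly_ring_induct)
    case (Var j)
    show ?case by (simp add: \<sigma>_def)
  next
    case (add p q)
    have "p + q - poly_subst \<sigma> (p + q) = (p - poly_subst \<sigma> p) + (q - poly_subst \<sigma> q)"
      by (simp add: poly_subst_add)
    then show ?case using add by (metis dvd_add)
  next
    case (mult p q)
    have "p * q - poly_subst \<sigma> (p * q)
        = (p - poly_subst \<sigma> p) * q + poly_subst \<sigma> p * (q - poly_subst \<sigma> q)"
      by (simp add: poly_subst_mult algebra_simps)
    then show ?case using mult by (metis dvd_add dvd_mult dvd_mult2)
  qed simp
  have "poly_subst \<sigma> p = 0" if "\<forall>v. poly_eval v (lin b) = 0 \<longrightarrow> poly_eval v p = 0" for p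
    by (rule poly_eval_eq_0D) (use that in \<open>simp only: eval \<pi>_ker simp_thms\<close>)
  moreover have vanish: "poly_eval v p = 0" if "lin b dvd p" "poly_eval v (lin b) = 0" for p v
    using that by (auto elim!: dvdE)
  moreover have "lin b dvd p" if "poly_subst \<sigma> p = 0" for p
    using cong[of p] that by simp
  ultimately have "lin b dvd p \<longleftrightarrow> poly_subst \<sigma> p = 0"
    and "poly_subst \<sigma> p = 0 \<longleftrightarrow> (\<forall>v. poly_eval v (lin b) = 0 \<longrightarrow> poly_eval v p = 0)" for p
    by blast+
  then show ?thesis by (rule that)
qed

lemma lin_dvd_iff:
  assumes "b \<noteq> 0"
  shows "lin b dvd p \<longleftrightarrow> (\<forall>v. poly_eval v (lin b) = 0 \<longrightarrow> poly_eval v p = 0)"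
  using lin_dvd_iff_subst[OF assms] by metis

text \<open>By \<open>lin_dvd_iff_subst\<close> the multiples of \<open>lin b\<close> form the
  kernel of a ring homomorphism into an integral domain.\<close>

lemma prime_elem_lin:
  fixes b :: "'n::{finite,linorder} cvec"
  assumes "b \<noteq> 0"
  shows "prime_elem (lin b)"
proof (rule prime_elemI)
  obtain \<sigma> where \<sigma>: "\<And>p. lin b dvd p \<longleftrightarrow> poly_subst \<sigma> p = 0"
    using lin_dvd_iff_subst[OF assms] by metis
  show "\<not> lin b dvd 1" by (simp add: \<sigma>)
  show "lin b dvd p \<or> lin b dvd q" if "lin b dvd p * q" for p q
    using that by (simp add: \<sigma> poly_subst_mult)
qed (use assms in simp)

lemma prime_elem_power_dvd_cancel:
  fixes p :: "'a::idom"
  assumes "prime_elem p" "\<not> p dvd c" "p ^ k dvd c * x"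
  shows "p ^ k dvd x"
  using assms(3)
proof (induction k arbitrary: x)
  case (Suc k)
  then have "p dvd c * x" by (metis dvd_mult_left power_Suc)
  then obtain z where z: "x = p * z"
    using assms(1,2) by (auto simp: prime_elem_dvd_mult_iff elim: dvdE)
  have "p * p ^ k dvd p * (c * z)" using Suc.prems z by (simp add: mult_ac)
  then have "p ^ k dvd c * z"
    using assms(1) by (auto simp: prime_elem_def)
  then have "p ^ k dvd z" by (rule Suc.IH)
  then show ?case unfolding z power_Suc by (rule mult_dvd_mono[OF dvd_refl])
qed simp

section \<open>Generic linear forms\<close>

lemma generic_vector:
  fixes x :: "'n::{finite,linorder} cvec"
  assumes "finite Z" "0 \<notin> Z"
  obtains a b where "x = a + b" "\<And>z. z \<in> Z \<Longrightarrow> poly_eval z (lin a) \<noteq> 0 \<and> poly_eval z (lin b) \<noteq> 0"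
proof -
  \<comment> \<open>If \<open>F\<close> is nonzero at \<open>a\<close>, then neither
    \<open>a\<close> nor \<open>x - a\<close> pairs to zero with any \<open>z\<close> in
    \<open>Z\<close>. All factors of \<open>F\<close> are nonzero polynomials, so such a point
    exists.\<close>
  define F where "F = (\<Prod>z\<in>Z. lin z * (Const (poly_eval x (lin z)) - lin z))"
  have "Const c - lin z \<noteq> 0" if "z \<in> Z" for c z
  proof
    assume eq: "Const c - lin z = 0"
    then have "poly_eval 0 (Const c - lin z) = 0" by simp
    then have "c = 0" by (simp add: poly_eval_lin)
    with eq that assms(2) show False by auto
  qed
  moreover have "lin z \<noteq> 0" if "z \<in> Z" for z using that assms(2) by auto
  ultimately have "F \<noteq> 0" using assms(1) by (simp add: F_def)
  then obtain a where a: "poly_eval a F \<noteq> 0" using poly_eval_eq_0D by blast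
  show ?thesis
  proof (rule that[of a "x - a"])
    fix z assume "z \<in> Z"
    then have "poly_eval a (lin z) \<noteq> 0 \<and> poly_eval x (lin z) - poly_eval a (lin z) \<noteq> 0"
      using a assms(1) by (simp add: F_def)
    then show "poly_eval z (lin a) \<noteq> 0 \<and> poly_eval z (lin (x - a)) \<noteq> 0"
      by (simp add: lin_diff poly_eval_lin_commute[of z])
  qed simp
qed

text \<open>A variable is a sum of two linear forms without zeros in \<open>Z\<close>. Statements
  stable under sums and products therefore need only be checked on constants and on generic linear
  forms.\<close>

lemma mpoly_generic_induct [consumes 2, case_names Const lin add mult]:
  fixes p :: "'n::{finite,linorder} mpoly"
  assumes "finite Z" "0 \<notin> Z"
    and Const: "\<And>c. P (Const c)"
    and lin: "\<And>a. (\<And>z. z \<in> Z \<Longrightarrow> poly_eval z (lin a) \<noteq> 0) \<Longrightarrow> P (lin a)"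
    and add: "\<And>p q. P p \<Longrightarrow> P q \<Longrightarrow> P (p + q)"
    and mult: "\<And>p q. P p \<Longrightarrow> P q \<Longrightarrow> P (p * q)"
  shows "P p"
proof (induction p rule: mpoly_ring_induct)
  case (Var i)
  obtain a b where "axis i 1 = a + b"
    "\<And>z. z \<in> Z \<Longrightarrow> poly_eval z (lin a) \<noteq> 0 \<and> poly_eval z (lin b) \<noteq> 0"
    using generic_vector[OF assms(1,2)] by metis
  then show ?case by (simp add: Var_eq_lin lin_add add lin)
qed (fact Const add mult)+

section \<open>Localisation at a linear form\<close>

text \<open>Membership in the local ring at the prime ideal of \<open>lin b\<close>. A pole of order
  at most \<open>k\<close> is expressed as regularity of \<open>lin b ^ k\<close> times the
  fraction.\<close>

definition regular :: "'n::{finite,linorder} cvec \<Rightarrow> 'n mpoly fract \<Rightarrow> bool" where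
  "regular b F \<longleftrightarrow> (\<exists>c g. \<not> lin b dvd c \<and> to_fract c * F = to_fract g)"

lemma regular_to_fract:
  assumes "b \<noteq> 0"
  shows "regular b (to_fract p)"
  unfolding regular_def
  by (rule exI[of _ 1], rule exI[of _ p]) (use prime_elem_lin[OF assms] in \<open>simp add: prime_elem_def\<close>)

lemma regular_add:
  assumes "b \<noteq> 0" "regular b F" "regular b G"
  shows "regular b (F + G)"
proof -
  obtain c g d h where cg: "\<not> lin b dvd c" "to_fract c * F = to_fract g"
    and dh: "\<not> lin b dvd d" "to_fract d * G = to_fract h"
    using assms by (auto simp: regular_def)
  have "to_fract (c * d) * (F + G) = to_fract d * (to_fract c * F) + to_fract c * (to_fract d * G)"
    by (simp add: algebra_simps)
  also have "\<dots> = to_fract (d * g + c * h)" by (simp add: cg dh)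
  finally show ?thesis
    using cg(1) dh(1) prime_elem_dvd_mult_iff[OF prime_elem_lin[OF assms(1)]]
    unfolding regular_def by blast
qed

lemma regular_mult:
  assumes "b \<noteq> 0" "regular b F" "regular b G"
  shows "regular b (F * G)"
proof -
  obtain c g d h where cg: "\<not> lin b dvd c" "to_fract c * F = to_fract g"
    and dh: "\<not> lin b dvd d" "to_fract d * G = to_fract h"
    using assms by (auto simp: regular_def)
  have "to_fract (c * d) * (F * G) = (to_fract c * F) * (to_fract d * G)"
    by (simp add: algebra_simps)
  also have "\<dots> = to_fract (g * h)" by (simp add: cg dh)
  finally show ?thesis
    using cg(1) dh(1) prime_elem_dvd_mult_iff[OF prime_elem_lin[OF assms(1)]]
    unfolding regular_def by blast
qed

lemma regular_sum:
  assumes "b \<noteq> 0" "\<And>i. i \<in> A \<Longrightarrow> regular b (F i)"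
  shows "regular b (sum F A)"
  using assms(2)
  by (induction A rule: infinite_finite_induct)
    (use regular_add[OF assms(1)] regular_to_fract[OF assms(1), of 0] in auto)

section \<open>Products of linear forms as denominators\<close>

inductive lin_product :: "'n::finite mpoly \<Rightarrow> bool" where
  one: "lin_product 1"
| lin: "b \<noteq> 0 \<Longrightarrow> lin_product p \<Longrightarrow> lin_product (lin b * p)"

lemma lin_product_mult: "lin_product p \<Longrightarrow> lin_product q \<Longrightarrow> lin_product (p * q)"
  by (induction rule: lin_product.induct) (simp_all add: mult.assoc lin_product.lin)

lemma lin_product_prod:
  assumes "\<And>i. i \<in> A \<Longrightarrow> lin_product (f i)"
  shows "lin_product (prod f A)"
  using assms by (induction A rule: infinite_finite_induct) (auto intro: lin_product.one lin_product_mult)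

lemma lin_product_lin: "b \<noteq> 0 \<Longrightarrow> lin_product (lin b)"
  using lin_product.lin[OF _ lin_product.one] by simp

lemma lin_product_nonzero: "lin_product (p :: 'n::{finite,linorder} mpoly) \<Longrightarrow> p \<noteq> 0"
  by (induction rule: lin_product.induct) simp_all

text \<open>Linear forms are prime, so the factors of \<open>B\<close> cancel one at a time.\<close>

lemma polynomial_if_regular:
  assumes "lin_product B" "to_fract B * F = to_fract g"
    and regular: "\<And>b. b \<noteq> 0 \<Longrightarrow> regular b F"
  obtains q where "F = to_fract q"
proof -
  have "\<exists>q. F = to_fract q"
    using assms(1,2)
  proof (induction B arbitrary: g rule: lin_product.induct)
    case one
    then show ?case by auto
  next
    case (lin b B)
    obtain c h where c: "\<not> lin b dvd c" and h: "to_fract c * F = to_fract h"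
      using regular[OF lin.hyps(1)] by (auto simp: regular_def)
    have "to_fract (c * g) = to_fract (lin b * B) * (to_fract c * F)"
      by (simp add: lin.prems[symmetric] algebra_simps)
    also have "\<dots> = to_fract (lin b * (B * h))" by (simp add: h)
    finally have "c * g = lin b * (B * h)" by (simp only: to_fract_eq_iff)
    then have "lin b dvd g"
      using c prime_elem_dvd_mult_iff[OF prime_elem_lin[OF lin.hyps(1)]] by (metis dvd_triv_left)
    then obtain g' where g': "g = lin b * g'" ..
    have "to_fract (lin b) * (to_fract B * F) = to_fract (lin b) * to_fract g'"
      using lin.prems by (simp add: g' mult.assoc)
    then have "to_fract B * F = to_fract g'" using lin.hyps(1) by simp
    then show ?case by (rule lin.IH)
  qed
  then show ?thesis using that by blast
qed

section \<open>Derivations preserving the invariants\<close>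

text \<open>Taken with \<open>f = act w\<close>, this lets the group act on the coefficients of a
  product of linear factors.\<close>

lemma map_poly_hom_mult:
  fixes f :: "'a::comm_ring_1 \<Rightarrow> 'a"
  assumes "f 0 = 0" "\<And>x y. f (x + y) = f x + f y" "\<And>x y. f (x * y) = f x * f y"
  shows "map_poly f (p * q) = map_poly f p * map_poly f q"
proof (rule poly_eqI)
  fix k
  have "f (sum g A) = (\<Sum>a\<in>A. f (g a))" for g :: "nat \<Rightarrow> 'a" and A
    by (induction A rule: infinite_finite_induct) (simp_all add: assms)
  then show "coeff (map_poly f (p * q)) k = coeff (map_poly f p * map_poly f q) k"
    by (simp add: coeff_map_poly coeff_mult assms)
qed

lemma of_nat_mpoly: "(of_nat k :: 'n::finite mpoly) = Const (of_nat k)"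
proof (rule poly_eval_eqI)
  show "poly_eval v (of_nat k) = poly_eval v (Const (of_nat k) :: 'n mpoly)" for v
    by (induction k) simp_all
qed

section \<open>Finite matrix groups and orbit polynomials\<close>

locale matrix_group =
  fixes W :: "'n::{finite,linorder} cmat set"
  assumes finite_W: "finite W" and subgroup_W: "subgroup W GL"
begin

lemma invertible_W: "w \<in> W \<Longrightarrow> invertible w"
  using subgroup.subset[OF subgroup_W] by (auto simp: GL_def)

lemma one_W [simp]: "mat 1 \<in> W"
  using subgroup.one_closed[OF subgroup_W] by (simp add: GL_def)

lemma mult_W: "w \<in> W \<Longrightarrow> w' \<in> W \<Longrightarrow> w ** w' \<in> W"
  using subgroup.m_closed[OF subgroup_W] by (simp add: GL_def)

lemma matrix_inv_W:
  assumes "w \<in> W"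
  shows "matrix_inv w \<in> W"
proof -
  interpret GL: group "GL :: 'n cmat monoid" by (rule group_GL)
  have "inv\<^bsub>GL\<^esub> w \<in> W" using subgroup.m_inv_closed[OF subgroup_W assms] .
  moreover have "w ** inv\<^bsub>GL\<^esub> w = mat 1"
    using GL.r_inv[of w] invertible_W[OF assms] by (simp add: GL_def)
  then have "w *v (inv\<^bsub>GL\<^esub> w *v v) = v" for v by (simp add: matrix_vector_mul_assoc)
  then have "matrix_inv w *v v = inv\<^bsub>GL\<^esub> w *v v" for v
    using matrix_inv_cancel(2)[OF invertible_W[OF assms]] by metis
  then have "matrix_inv w = inv\<^bsub>GL\<^esub> w" by (simp add: matrix_eq)
  ultimately show ?thesis by simp
qed

lemma matrix_inv_mult_W:
  assumes "w \<in> W"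
  shows "w ** matrix_inv w = mat 1" "matrix_inv w ** w = mat 1"
  using matrix_inv_cancel[OF invertible_W[OF assms]]
  by (simp_all add: matrix_eq matrix_vector_mul_assoc[symmetric])

lemma left_mult_bij:
  assumes "w \<in> G" "G \<subseteq> W" "\<And>w w'. w \<in> G \<Longrightarrow> w' \<in> G \<Longrightarrow> w ** w' \<in> G"
    and "\<And>w. w \<in> G \<Longrightarrow> matrix_inv w \<in> G"
  shows "bij_betw ((**) w) G G"
proof (rule bij_betw_byWitness[of _ "(**) (matrix_inv w)"])
  have "w \<in> W" using assms(1,2) by auto
  then show "\<forall>w'\<in>G. matrix_inv w ** (w ** w') = w'" "\<forall>w'\<in>G. w ** (matrix_inv w ** w') = w'"
    by (simp_all add: matrix_mul_assoc matrix_inv_mult_W)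
qed (use assms in auto)

lemma act_matrix_inv_fixed:
  assumes "w \<in> W" "w \<noteq> mat 1"
  obtains v where "v - matrix_inv w *v v \<noteq> 0"
proof -
  have "\<exists>v. w *v v \<noteq> v" using assms(2) by (auto simp: matrix_eq)
  then obtain v where v: "w *v v \<noteq> v" ..
  have "v - matrix_inv w *v v \<noteq> 0"
    using v matrix_inv_cancel(1)[OF invertible_W[OF assms(1)], of v] by auto
  then show ?thesis by (rule that)
qed

lemma Const_invariant [simp]: "Const c \<in> invariants W"
  by (simp add: invariants_def)

lemma invariants_add: "f \<in> invariants W \<Longrightarrow> g \<in> invariants W \<Longrightarrow> f + g \<in> invariants W"
  and invariants_mult: "f \<in> invariants W \<Longrightarrow> g \<in> invariants W \<Longrightarrow> f * g \<in> invariants W"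
  by (simp_all add: invariants_def act_simps)

text \<open>The product runs over the group and not over the set of conjugates, so \<open>u\<close>
  is a simple root exactly when its stabiliser is trivial. The derivative at \<open>u\<close> is
  then a nonzero denominator for \<open>D u\<close>.\<close>

definition orbit_poly :: "'n mpoly \<Rightarrow> 'n mpoly poly" where
  "orbit_poly u = (\<Prod>w\<in>W. [:- act w u, 1:])"

text \<open>Acting by \<open>w\<close> on the coefficients permutes the linear factors through left
  multiplication on \<open>W\<close>.\<close>

lemma coeff_orbit_poly: "coeff (orbit_poly u) k \<in> invariants W"
  unfolding invariants_def
proof (intro CollectI ballI)
  fix w assume w: "w \<in> W"
  have "map_poly (act w) (\<Prod>x\<in>A. [:- act x u, 1:]) = (\<Prod>x\<in>A. [:- act w (act x u), 1:])" for A
    by (induction A rule: infinite_finite_induct)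
      (simp_all add: map_poly_hom_mult act_simps map_poly_pCons del: mult_pCons_left)
  then have "map_poly (act w) (orbit_poly u) = (\<Prod>x\<in>W. [:- act w (act x u), 1:])"
    by (simp add: orbit_poly_def)
  also have "\<dots> = (\<Prod>x\<in>W. [:- act (w ** x) u, 1:])"
    using w by (intro prod.cong) (simp_all add: act_act invertible_W)
  also have "\<dots> = orbit_poly u"
    unfolding orbit_poly_def
    by (rule prod.reindex_bij_betw[OF left_mult_bij[OF w], where g = "\<lambda>x. [:- act x u, 1:]"])
      (auto intro: mult_W matrix_inv_W)
  finally show "act w (coeff (orbit_poly u) k) = coeff (orbit_poly u) k"
    by (metis coeff_map_poly act_0)
qed

lemma act_poly:
  assumes "\<And>k. coeff P k \<in> invariants W" "w \<in> W"
  shows "act w (poly P u) = poly P (act w u)"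
  using assms(1)
proof (induction P)
  case (pCons c P)
  have "c \<in> invariants W" using pCons.prems[of 0] by simp
  moreover have "coeff P k \<in> invariants W" for k using pCons.prems[of "Suc k"] by simp
  ultimately show ?case
    using pCons.IH assms(2) by (simp add: act_simps invariants_def)
qed simp

lemma poly_orbit_poly:
  assumes "w \<in> W"
  shows "poly (orbit_poly u) (act w u) = 0"
  using assms finite_W by (auto simp: orbit_poly_def poly_prod)

text \<open>In the product rule only the term that differentiates the factor for
  \<open>mat 1\<close> survives at \<open>u\<close>.\<close>

lemma poly_pderiv_orbit_poly:
  "poly (pderiv (orbit_poly u)) u = (\<Prod>w\<in>W - {mat 1}. u - act w u)"
proof -
  have "orbit_poly u = [:- u, 1:] * (\<Prod>w\<in>W - {mat 1}. [:- act w u, 1:])"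
    unfolding orbit_poly_def using finite_W by (simp add: prod.remove[of W "mat 1"])
  then show ?thesis
    by (simp only: pderiv_mult) (simp add: pderiv_pCons poly_prod)
qed

end

locale invariant_derivation = matrix_group W
  for W :: "'n::{finite,linorder} cmat set" +
  fixes D :: "'n mpoly fract \<Rightarrow> 'n mpoly fract"
  assumes derivation: "derivation D"
    and D_invariants: "\<And>f. f \<in> invariants W \<Longrightarrow> D (to_fract f) \<in> to_fract ` invariants W"
begin

lemma D_add: "D (a + b) = D a + D b"
  and D_Const_mult: "D (to_fract (Const c) * a) = to_fract (Const c) * D a"
  and D_mult: "D (a * b) = a * D b + D a * b"
  using derivation by (auto simp: derivation_def)

lemma D_0 [simp]: "D 0 = 0"
  using D_add[of 0 0] by (metis add_cancel_right_right add_0)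

lemma D_Const [simp]: "D (to_fract (Const c)) = 0"
proof -
  have "D 1 = 0" using D_mult[of 1 1] by (metis add_cancel_right_right mult_1 mult_1_right)
  then show ?thesis using D_Const_mult[of c 1] by simp
qed

lemma D_sum: "D (sum f A) = (\<Sum>a\<in>A. D (f a))"
  by (induction A rule: infinite_finite_induct) (simp_all add: D_add)

lemma D_power: "D (a ^ Suc k) = of_nat (Suc k) * a ^ k * D a"
  by (induction k) (simp_all add: D_mult algebra_simps)

text \<open>\<open>Q\<close> is \<open>P\<close> with \<open>D\<close> applied to the coefficients,
  and the formula is the chain rule. One \<open>Q\<close> with invariant coefficients serves all
  \<open>u\<close>, hence all conjugates of a given polynomial.\<close>

lemma D_poly:
  assumes "\<And>k. coeff P k \<in> invariants W"
  shows "\<exists>Q. (\<forall>k. coeff Q k \<in> invariants W) \<and>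
    (\<forall>u. D (to_fract (poly P u)) = to_fract (poly Q u) + to_fract (poly (pderiv P) u) * D (to_fract u))"
  using assms
proof (induction P)
  case 0
  show ?case by (rule exI[of _ 0]) (use Const_invariant[of 0] in simp)
next
  case (pCons c P)
  have "c \<in> invariants W" using pCons.prems[of 0] by simp
  then obtain c' where c': "c' \<in> invariants W" "D (to_fract c) = to_fract c'"
    using D_invariants by blast
  have "coeff P k \<in> invariants W" for k using pCons.prems[of "Suc k"] by simp
  then obtain Q where Q: "\<forall>k. coeff Q k \<in> invariants W"
    "\<And>u. D (to_fract (poly P u)) = to_fract (poly Q u) + to_fract (poly (pderiv P) u) * D (to_fract u)"
    using pCons.IH by blast
  show ?case
  proof (intro exI[of _ "pCons c' Q"] conjI allI)
    show "coeff (pCons c' Q) k \<in> invariants W" for k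
      using c' Q by (cases k) auto
    show "D (to_fract (poly (pCons c P) u)) =
        to_fract (poly (pCons c' Q) u) + to_fract (poly (pderiv (pCons c P)) u) * D (to_fract u)" for u
      by (simp add: D_add D_mult c' Q(2) pderiv_pCons algebra_simps)
  qed
qed

text \<open>Differentiate the monic equation over the invariants that \<open>u\<close> satisfies.\<close>

lemma D_clear_denominator:
  obtains g where "\<And>w. w \<in> W \<Longrightarrow>
    to_fract (act w (\<Prod>x\<in>W - {mat 1}. u - act x u)) * D (to_fract (act w u)) = to_fract (act w g)"
proof -
  let ?P = "orbit_poly u"
  obtain Q where Q: "\<And>k. coeff Q k \<in> invariants W"
    "\<And>u. D (to_fract (poly ?P u)) = to_fract (poly Q u) + to_fract (poly (pderiv ?P) u) * D (to_fract u)"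
    using D_poly[of ?P] coeff_orbit_poly by blast
  have coeff: "coeff (pderiv ?P) k \<in> invariants W" for k
    using coeff_orbit_poly[of u "Suc k"] Const_invariant[of "of_nat (Suc k)"]
    unfolding coeff_pderiv of_nat_mpoly by (intro invariants_mult)
  have "to_fract (act w (poly (pderiv ?P) u)) * D (to_fract (act w u)) = to_fract (act w (- poly Q u))"
    if w: "w \<in> W" for w
  proof -
    have "D (to_fract (poly ?P (act w u))) = 0"
      by (simp add: poly_orbit_poly w)
    then have "to_fract (poly (pderiv ?P) (act w u)) * D (to_fract (act w u)) = - to_fract (poly Q (act w u))"
      using Q(2)[of "act w u"] by (simp add: eq_neg_iff_add_eq_0 add.commute)
    then show ?thesis
      by (simp add: act_poly[OF Q(1) w] act_poly[OF coeff w] act_uminus)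
  qed
  then show ?thesis by (intro that[of "- poly Q u"]) (simp add: poly_pderiv_orbit_poly)
qed

text \<open>One pair \<open>c\<close>, \<open>g\<close> serves all group elements at once, which is
  the source of equivariance. For generic linear \<open>p\<close> the denominator is a product of
  nonzero linear forms; under sums and products the denominators multiply.\<close>

lemma D_lin_product_denominator:
  "\<exists>c g. lin_product c \<and> (\<forall>w\<in>W. to_fract (act w c) * D (to_fract (act w p)) = to_fract (act w g))"
proof -
  \<comment> \<open>The value of \<open>lin a\<close> at \<open>z w\<close> is that of
    \<open>lin a - act w (lin a)\<close> at \<open>v\<close>, so a form that is nonzero at
    \<open>z w\<close> is moved by \<open>w\<close>.\<close>
  define z where "z w = (SOME z. z \<noteq> 0 \<and> (\<exists>v. z = v - matrix_inv w *v v))" for w :: "'n cmat"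
  have z: "z w \<noteq> 0 \<and> (\<exists>v. z w = v - matrix_inv w *v v)" if "w \<in> W - {mat 1}" for w
    unfolding z_def by (rule someI_ex) (use act_matrix_inv_fixed[of w] that in blast)
  have "finite (z ` (W - {mat 1}))" using finite_W by simp
  moreover have "0 \<notin> z ` (W - {mat 1})" using z by (metis image_iff)
  ultimately show ?thesis
  proof (induction p rule: mpoly_generic_induct)
    case (Const c)
    show ?case by (rule exI[of _ 1], rule exI[of _ 0]) (simp add: lin_product.one)
  next
    case (lin a)
    obtain g where g: "\<And>w. w \<in> W \<Longrightarrow> to_fract (act w (\<Prod>x\<in>W - {mat 1}. lin a - act x (lin a)))
        * D (to_fract (act w (lin a))) = to_fract (act w g)"
      using D_clear_denominator by metis
    have "lin_product (lin a - act x (lin a))" if x: "x \<in> W - {mat 1}" for x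
    proof -
      obtain v where "z x = v - matrix_inv x *v v" using z[OF x] by auto
      then have "poly_eval v (lin a - act x (lin a)) \<noteq> 0"
        using lin[OF imageI[OF x]] by (simp add: poly_eval_lin_vec)
      moreover have "lin a - act x (lin a) = lin (a - a v* matrix_inv x)"
        by (simp add: lin_diff act_lin)
      ultimately show ?thesis
        by (metis lin_eq_0_iff lin_product_lin poly_eval_zero)
    qed
    then have "lin_product (\<Prod>x\<in>W - {mat 1}. lin a - act x (lin a))" by (rule lin_product_prod)
    then show ?case using g by (intro exI conjI ballI)
  next
    case (add p q)
    then obtain c g d h where c: "lin_product c" and d: "lin_product d"
      and g: "\<And>w. w \<in> W \<Longrightarrow> to_fract (act w c) * D (to_fract (act w p)) = to_fract (act w g)"
      and h: "\<And>w. w \<in> W \<Longrightarrow> to_fract (act w d) * D (to_fract (act w q)) = to_fract (act w h)"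
      by blast
    have "to_fract (act w (c * d)) * D (to_fract (act w (p + q))) = to_fract (act w (d * g + c * h))"
      if "w \<in> W" for w
      using g[OF that, symmetric] h[OF that, symmetric] by (simp add: act_simps D_add algebra_simps)
    then show ?case using lin_product_mult[OF c d] by (intro exI conjI ballI)
  next
    case (mult p q)
    then obtain c g d h where c: "lin_product c" and d: "lin_product d"
      and g: "\<And>w. w \<in> W \<Longrightarrow> to_fract (act w c) * D (to_fract (act w p)) = to_fract (act w g)"
      and h: "\<And>w. w \<in> W \<Longrightarrow> to_fract (act w d) * D (to_fract (act w q)) = to_fract (act w h)"
      by blast
    have "to_fract (act w (c * d)) * D (to_fract (act w (p * q)))
        = to_fract (act w (d * q * g + c * p * h))" if "w \<in> W" for w
      using g[OF that, symmetric] h[OF that, symmetric] by (simp add: act_simps D_mult algebra_simps)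
    then show ?case using lin_product_mult[OF c d] by (intro exI conjI ballI)
  qed
qed

text \<open>Equivariance of \<open>D\<close>, stated without extending the action to fractions.\<close>

lemma D_act:
  assumes "w \<in> W" "to_fract c * D (to_fract p) = to_fract g"
  shows "to_fract (act w c) * D (to_fract (act w p)) = to_fract (act w g)"
proof -
  obtain d h where "lin_product d"
    and h: "\<And>w. w \<in> W \<Longrightarrow> to_fract (act w d) * D (to_fract (act w p)) = to_fract (act w h)"
    using D_lin_product_denominator by blast
  then have d: "act w d \<noteq> 0"
    using lin_product_nonzero act_eq_0_iff[OF invertible_W[OF assms(1)]] by blast
  \<comment> \<open>Comparing the two denominators gives a polynomial identity to which
    \<open>act w\<close> applies; the common factor \<open>act w d\<close> cancels at the
    end.\<close>
  have "to_fract (d * g) = to_fract c * (to_fract d * D (to_fract p))"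
    by (simp add: assms(2)[symmetric] algebra_simps)
  also have "\<dots> = to_fract (c * h)" using h[of "mat 1"] by simp
  finally have "d * g = c * h" by (simp only: to_fract_eq_iff)
  then have eq: "act w d * act w g = act w c * act w h" by (simp flip: act_mult)
  have "to_fract (act w d) * (to_fract (act w c) * D (to_fract (act w p)))
      = to_fract (act w c) * (to_fract (act w d) * D (to_fract (act w p)))"
    by (simp add: algebra_simps)
  also have "\<dots> = to_fract (act w c * act w h)" using h[OF assms(1)] by simp
  also have "\<dots> = to_fract (act w d) * to_fract (act w g)" by (simp add: eq[symmetric])
  finally show ?thesis using d by simp
qed

lemma D_act_polynomial:
  assumes "w \<in> W" "D (to_fract p) = to_fract q"
  shows "D (to_fract (act w p)) = to_fract (act w q)"
  using D_act[OF assms(1), of 1 p q] assms(2) by simp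

end

section \<open>The pointwise stabiliser of a hyperplane\<close>

context matrix_group
begin

abbreviation stab :: "'n cvec \<Rightarrow> 'n cmat set" where
  "stab b \<equiv> pointwise_stabiliser W {v. poly_eval v (lin b) = 0}"

lemma stab_subset: "stab b \<subseteq> W"
  by (auto simp: pointwise_stabiliser_def)

lemma stab_W: "w \<in> stab b \<Longrightarrow> w \<in> W"
  using stab_subset by auto

lemma finite_stab: "finite (stab b)"
  using finite_subset[OF stab_subset finite_W] .

lemma stab_fix:
  assumes "w \<in> stab b" "poly_eval v (lin b) = 0"
  shows "w *v v = v" "matrix_inv w *v v = v"
proof -
  show "w *v v = v" using assms by (auto simp: pointwise_stabiliser_def)
  then show "matrix_inv w *v v = v"
    using matrix_inv_cancel(2)[OF invertible_W[OF stab_W[OF assms(1)]], of v] by simp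
qed

lemma one_stab [simp]: "mat 1 \<in> stab b"
  by (simp add: pointwise_stabiliser_def)

lemma mult_stab: "w \<in> stab b \<Longrightarrow> w' \<in> stab b \<Longrightarrow> w ** w' \<in> stab b"
  by (auto simp: pointwise_stabiliser_def mult_W matrix_vector_mul_assoc[symmetric])

lemma matrix_inv_stab: "w \<in> stab b \<Longrightarrow> matrix_inv w \<in> stab b"
  using stab_fix(2)[of w b] by (auto simp: pointwise_stabiliser_def matrix_inv_W)

lemma card_stab_pos: "card (stab b) > 0"
  using finite_stab[of b] one_stab[of b] by (metis card_gt_0_iff empty_iff)

lemma bij_betw_stab: "w \<in> stab b \<Longrightarrow> bij_betw ((**) w) (stab b) (stab b)"
  by (rule left_mult_bij[OF _ stab_subset]) (auto intro: mult_stab matrix_inv_stab)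

lemma act_lin_stab:
  assumes "b \<noteq> 0" "w \<in> stab b"
  obtains c where "act w (lin b) = Const c * lin b"
proof -
  have "poly_eval v (lin (b v* matrix_inv w)) = 0" if "poly_eval v (lin b) = 0" for v
    using that stab_fix(2)[OF assms(2) that] by (simp flip: act_lin)
  then obtain c where "b v* matrix_inv w = c *s b"
    using lin_proportional[OF assms(1)] by metis
  then show ?thesis by (intro that[of c]) (simp add: act_lin lin_scale)
qed

text \<open>
  Such an element is a transvection, \<open>w v = v + t v\<close> with \<open>w (t v) = t v\<close>, so
  \<open>w\<^sup>k v = v + k t v\<close>, which takes only finitely many values.
\<close>

lemma stab_fixes_lin:
  assumes w: "w \<in> stab b" and fix_lin: "act w (lin b) = lin b"
  shows "w = mat 1"
proof -
  have "w *v v = v" for v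
  proof (rule ccontr)
    define t where "t = w *v v - v"
    assume "w *v v \<noteq> v"
    then have "t \<noteq> 0" by (simp add: t_def)
    have "poly_eval (w *v v) (lin b) = poly_eval v (lin b)"
      using poly_eval_act[of "w *v v" w "lin b"] fix_lin
      by (simp add: matrix_inv_cancel[OF invertible_W[OF stab_W[OF w]]])
    then have "poly_eval t (lin b) = 0" by (simp add: t_def poly_eval_lin_vec)
    then have wt: "w *v t = t" by (rule stab_fix[OF w])
    have iter: "((*v) w ^^ k) v = v + of_nat k *s t" for k
    proof (induction k)
      case (Suc k)
      have "w *v v = v + t" by (simp add: t_def)
      then have "w *v (v + of_nat k *s t) = v + t + of_nat k *s t"
        by (simp only: matrix_vector_right_distrib vector_scalar_commute wt)
      then have "((*v) w ^^ Suc k) v = v + t + of_nat k *s t" by (simp only: funpow.simps o_apply Suc)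
      then show ?case by (simp add: vec_eq_iff algebra_simps)
    qed simp
    have "((*v) w ^^ k) v \<in> (\<lambda>x. x *v v) ` W" for k
    proof (induction k)
      case 0
      show ?case by (rule image_eqI[of _ _ "mat 1"]) simp_all
    next
      case (Suc k)
      then obtain x where "x \<in> W" "((*v) w ^^ k) v = x *v v" by auto
      then show ?case
        using mult_W[OF stab_W[OF w]]
        by (intro image_eqI[of _ _ "w ** x"]) (simp_all add: matrix_vector_mul_assoc)
    qed
    then have "range (\<lambda>k. v + of_nat k *s t) \<subseteq> (\<lambda>x. x *v v) ` W"
      by (auto simp flip: iter)
    then have "finite (range (\<lambda>k. v + of_nat k *s t))"
      using finite_W finite_surj by blast
    moreover have "inj (\<lambda>k::nat. v + of_nat k *s t)"
      using \<open>t \<noteq> 0\<close> by (auto intro!: injI)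
    ultimately show False using range_inj_infinite by blast
  qed
  then show ?thesis by (simp add: matrix_eq)
qed

text \<open>\<open>w\<close> has an eigenvector off the hyperplane with eigenvalue
  \<open>l \<noteq> 1\<close>. Together with a basis of the hyperplane it diagonalises
  \<open>w\<close>, so \<open>det w = l\<close>.\<close>

lemma det_stab_neq_1:
  assumes "b \<noteq> 0" and w: "w \<in> stab b" and "w \<noteq> mat 1"
  shows "det w \<noteq> 1"
proof -
  obtain i where i: "b $ i \<noteq> 0" using assms(1) by (auto simp: vec_eq_iff)
  \<comment> \<open>\<open>lin b\<close> takes the value 1 at \<open>e\<close>, so \<open>l\<close>
    is the factor by which \<open>w\<close> acts on the quotient of \<open>V\<close> by the
    hyperplane.\<close>
  define e where "e = (1 / b $ i) *s axis i (1::complex)"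
  define l where "l = poly_eval (w *v e) (lin b)"
  have e: "poly_eval e (lin b) = 1"
    using i by (simp add: e_def poly_eval_lin_vec poly_eval_lin_axis)
  have eval_w: "poly_eval (w *v v) (lin b) = l * poly_eval v (lin b)" for v
  proof -
    have "poly_eval (v - poly_eval v (lin b) *s e) (lin b) = 0"
      by (simp add: poly_eval_lin_vec e)
    then have "w *v (v - poly_eval v (lin b) *s e) = v - poly_eval v (lin b) *s e"
      by (rule stab_fix[OF w])
    then have "w *v v = v - poly_eval v (lin b) *s e + poly_eval v (lin b) *s (w *v e)"
      by (simp add: matrix_vector_mult_diff_distrib vector_scalar_commute algebra_simps)
    then show ?thesis by (simp add: poly_eval_lin_vec e l_def)
  qed
  have "l \<noteq> 1"
  proof
    assume "l = 1"
    then have "poly_eval (matrix_inv w *v v) (lin b) = poly_eval v (lin b)" for v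
      using eval_w[of "matrix_inv w *v v"]
      by (simp add: matrix_inv_cancel[OF invertible_W[OF stab_W[OF w]]])
    then have "act w (lin b) = lin b" by (intro poly_eval_eqI) simp
    with stab_fixes_lin[OF w] assms(3) show False by simp
  qed
  \<comment> \<open>\<open>w *v e - l *s e\<close> lies in the hyperplane and is fixed by
    \<open>w\<close>; adding this multiple of it to \<open>e\<close> solves
    \<open>w *v a = l *s a\<close>.\<close>
  define a where "a = e + (1 / (l - 1)) *s (w *v e - l *s e)"
  have ker: "poly_eval (w *v e - l *s e) (lin b) = 0"
    by (simp add: poly_eval_lin_vec e l_def)
  have a: "poly_eval a (lin b) = 1"
    unfolding a_def poly_eval_lin_vec(1) poly_eval_lin_vec(3) ker e by simp
  have "w *v a = w *v e + (1 / (l - 1)) *s (w *v e - l *s e)"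
    by (simp only: a_def matrix_vector_right_distrib vector_scalar_commute stab_fix(1)[OF w ker])
  also have "\<dots> = l *s a"
    using \<open>l \<noteq> 1\<close> by (simp add: a_def vec_eq_iff divide_simps) (simp add: algebra_simps)
  finally have wa: "w *v a = l *s a" .
  \<comment> \<open>The new basis: \<open>a\<close> at position \<open>i\<close>, and elsewhere the
    unit vectors projected to the hyperplane along axis \<open>i\<close>.\<close>
  define col where "col c = (if c = i then a else axis c 1 - (b $ c / b $ i) *s axis i 1)" for c
  have col_ker: "poly_eval (col c) (lin b) = (if c = i then 1 else 0)" for c
    using i a by (simp add: col_def poly_eval_lin_vec poly_eval_lin_axis)
  have col_i: "col i = a" by (simp add: col_def)
  define P :: "'n cmat" where "P = (\<chi> r c. col c $ r)"
  define L :: "'n cmat" where "L = (\<chi> r c. if r = c then (if c = i then l else 1) else 0)"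
  have "w ** P = P ** L"
  proof -
    have "(w ** P) $ r $ c = (P ** L) $ r $ c" for r c
    proof -
      have "(w ** P) $ r $ c = (w *v col c) $ r"
        by (simp add: matrix_matrix_mult_def matrix_vector_mult_def P_def)
      also have "w *v col c = (if c = i then l else 1) *s col c"
        using wa stab_fix(1)[OF w, of "col c"] col_ker[of c] col_i by (cases "c = i") simp_all
      also have "\<dots> $ r = (\<Sum>k\<in>UNIV. if k = c then col c $ r * (if c = i then l else 1) else 0)"
        by simp
      also have "\<dots> = (P ** L) $ r $ c"
        unfolding matrix_matrix_mult_def vec_lambda_beta
        by (intro sum.cong) (auto simp: P_def L_def)
      finally show ?thesis .
    qed
    then show ?thesis by (simp add: vec_eq_iff)
  qed
  then have "det w * det P = det P * det L" by (metis det_mul)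
  moreover have "det L = l"
  proof -
    have "det L = (\<Prod>k\<in>UNIV. L $ k $ k)" by (rule det_diagonal) (simp add: L_def)
    then show ?thesis by (simp add: L_def)
  qed
  moreover have "det P \<noteq> 0"
  proof -
    \<comment> \<open>Pairing with \<open>lin b\<close> isolates the coefficient of
      \<open>a\<close>; once it is zero, coordinate \<open>j\<close> of the sum is the coefficient
      of column \<open>j\<close>.\<close>
    have "x = 0" if Px: "P *v x = 0" for x
    proof -
      have Px_sum: "P *v x = (\<Sum>c\<in>UNIV. x $ c *s col c)"
        by (simp add: vec_eq_iff matrix_vector_mult_def P_def mult.commute)
      have "poly_eval (\<Sum>c\<in>A. x $ c *s col c) (lin b) = (\<Sum>c\<in>A. x $ c * poly_eval (col c) (lin b))" for A
        by (induction A rule: infinite_finite_induct) (simp_all add: poly_eval_lin_vec, simp_all add: poly_eval_lin)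
      then have "poly_eval (P *v x) (lin b) = x $ i"
        by (simp add: Px_sum col_ker if_distrib cong: if_cong)
      then have xi: "x $ i = 0" using Px by (simp add: poly_eval_lin)
      have "x $ j = 0" if "j \<noteq> i" for j
      proof -
        have "(P *v x) $ j = (\<Sum>c\<in>UNIV. if c = j then x $ j else 0)"
          unfolding Px_sum sum_component
          using that xi by (intro sum.cong) (auto simp: col_def axis_def)
        then show ?thesis using Px by simp
      qed
      with xi show "x = 0" by (metis vec_eq_iff zero_index)
    qed
    then have "invertible P"
      by (simp add: invertible_left_inverse matrix_left_invertible_ker)
    then show ?thesis by (simp add: invertible_det_nz)
  qed
  ultimately have "det w = l" by simp
  with \<open>l \<noteq> 1\<close> show ?thesis by simp
qed

section \<open>The determinant character and the operators \<open>e_op\<close>\<close>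

lemma det_stab_power:
  assumes "w \<in> stab b"
  shows "det w ^ card (stab b) = 1"
proof -
  \<comment> \<open>Left multiplication by \<open>w\<close> permutes the stabiliser, so the product
    of all determinants acquires the factor \<open>det w ^ card (stab b)\<close>.\<close>
  have "(\<Prod>x\<in>stab b. det x) = (\<Prod>x\<in>stab b. det (w ** x))"
    by (rule prod.reindex_bij_betw[OF bij_betw_stab[OF assms], symmetric])
  also have "\<dots> = det w ^ card (stab b) * (\<Prod>x\<in>stab b. det x)"
    by (simp add: det_mul prod.distrib)
  finally have "(\<Prod>x\<in>stab b. det x) = det w ^ card (stab b) * (\<Prod>x\<in>stab b. det x)" .
  moreover have "(\<Prod>x\<in>stab b. det x) \<noteq> 0"
    using finite_stab invertible_W[OF stab_W] by (auto simp: invertible_det_nz)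
  ultimately show ?thesis by simp
qed

text \<open>Summing over \<open>i\<close> first gives a geometric sum in \<open>det w\<close>. It
  vanishes for \<open>w \<noteq> mat 1\<close>, since \<open>det w\<close> is then a root of unity
  other than 1 with order dividing \<open>card (stab b)\<close>. The range includes
  \<open>i = 0\<close>.\<close>

lemma sum_e_op:
  assumes "b \<noteq> 0"
  shows "(\<Sum>i<card (stab b). e_op W {v. poly_eval v (lin b) = 0} i p) = Const (of_nat (card (stab b))) * p"
proof -
  let ?n = "card (stab b)"
  have "(\<Sum>i<?n. e_op W {v. poly_eval v (lin b) = 0} i p)
      = (\<Sum>w\<in>stab b. (\<Sum>i<?n. Const (det w ^ i)) * act w p)"
    unfolding e_op_def sum_distrib_right by (rule sum.swap)
  also have "\<dots> = (\<Sum>w\<in>stab b. if w = mat 1 then Const (of_nat ?n) * p else 0)"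
  proof (rule sum.cong[OF refl])
    fix w assume w: "w \<in> stab b"
    have "(\<Sum>i<?n. Const (det w ^ i) :: 'n mpoly) = Const (\<Sum>i<?n. det w ^ i)"
      by (rule poly_eval_eqI) simp
    moreover have "(\<Sum>i<?n. det w ^ i) = 0" if "w \<noteq> mat 1"
      using det_stab_neq_1[OF assms w that] det_stab_power[OF w] by (simp add: geometric_sum)
    ultimately show "(\<Sum>i<?n. Const (det w ^ i)) * act w p
        = (if w = mat 1 then Const (of_nat ?n) * p else 0)"
      by (cases "w = mat 1") (simp_all add: det_I)
  qed
  also have "\<dots> = Const (of_nat ?n) * p" using finite_stab by simp
  finally show ?thesis .
qed

text \<open>A fixed vector outside the hyperplane would span \<open>V\<close> together with it and
  force \<open>w = mat 1\<close>. So nontrivial stabilisers occur only on reflection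
  hyperplanes.\<close>

lemma hyperplane_in_arrangement:
  assumes "b \<noteq> 0" and w: "w \<in> stab b" "w \<noteq> mat 1"
  shows "{v. poly_eval v (lin b) = 0} \<in> arrangement W"
proof -
  let ?H = "{v. poly_eval v (lin b) = 0}"
  have split: "u = (u - (poly_eval u (lin b) / poly_eval v (lin b)) *s v)
      + (poly_eval u (lin b) / poly_eval v (lin b)) *s v" for u v
    by simp
  have ker: "u - (poly_eval u (lin b) / poly_eval v (lin b)) *s v \<in> ?H"
    if "poly_eval v (lin b) \<noteq> 0" for u v
    using that by (simp add: poly_eval_lin_vec)
  have "fixed_space w = ?H"
  proof
    show "?H \<subseteq> fixed_space w" using stab_fix(1)[OF w(1)] by (auto simp: fixed_space_def)
    show "fixed_space w \<subseteq> ?H"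
    proof (rule ccontr)
      assume "\<not> fixed_space w \<subseteq> ?H"
      then obtain v where v: "w *v v = v" "poly_eval v (lin b) \<noteq> 0" by (auto simp: fixed_space_def)
      have "w *v u = u" for u
      proof -
        have "w *v (u - (poly_eval u (lin b) / poly_eval v (lin b)) *s v)
            = u - (poly_eval u (lin b) / poly_eval v (lin b)) *s v"
          using stab_fix(1)[OF w(1)] ker[OF v(2)] by blast
        then show ?thesis
          by (simp add: matrix_vector_mult_diff_distrib vector_scalar_commute v(1))
      qed
      then show False using w(2) by (simp add: matrix_eq)
    qed
  qed
  moreover have "vec.dim ?H = CARD('n) - 1"
  proof -
    obtain i where "b $ i \<noteq> 0" using assms(1) by (auto simp: vec_eq_iff)
    then have i: "poly_eval (axis i 1) (lin b) \<noteq> 0" by (simp add: poly_eval_lin_axis)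
    have "vec.subspace ?H"
      by (auto simp: vec.subspace_def poly_eval_lin_vec) (simp add: poly_eval_lin)
    then have "axis i 1 \<notin> vec.span ?H"
      using i by (simp add: vec.span_eq_iff[THEN iffD2])
    then have "vec.dim (insert (axis i 1) ?H) = vec.dim ?H + 1"
      by (simp add: vec.dim_insert)
    moreover have "vec.span (insert (axis i 1) ?H) = UNIV"
    proof -
      have "u \<in> vec.span (insert (axis i 1) ?H)" for u
        by (subst split[of u "axis i 1"], intro vec.span_add vec.span_scale vec.span_base)
          (use ker[OF i] in auto)
      then show ?thesis by auto
    qed
    then have "vec.dim (insert (axis i 1) ?H) = CARD('n)"
      by (metis vec.dim_span vec_dim_card)
    ultimately show ?thesis by simp
  qed
  ultimately show ?thesis
    using stab_W[OF w(1)] by (auto simp: arrangement_def reflections_def)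
qed

end

lemma arrangement_lin:
  fixes W :: "'n::{finite,linorder} cmat set"
  assumes "H \<in> arrangement W" "defining_form H p"
  obtains a where "p = lin a" "a \<noteq> 0" "H = {v. poly_eval v (lin a) = 0}"
proof -
  obtain a where a: "p = lin a"
    using assms(2) homogeneous_1_lin by (auto simp: defining_form_def)
  then have H: "H = {v. poly_eval v (lin a) = 0}"
    using assms(2) by (auto simp: defining_form_def)
  have "a \<noteq> 0"
  proof
    assume "a = 0"
    then have "H = UNIV" using H by (simp add: poly_eval_lin)
    moreover have "vec.dim H = CARD('n) - 1"
      using assms(1) by (auto simp: arrangement_def reflections_def)
    ultimately have "CARD('n) = CARD('n) - 1" by (simp only: vec_dim_card)
    moreover have "CARD('n) > 0" by simp
    ultimately show False by linarith
  qed
  then show ?thesis using that[OF a _ H] by blast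
qed

section \<open>Poles of the derivation along a hyperplane\<close>

context invariant_derivation
begin

text \<open>
  For generic linear \<open>u\<close>, exactly \<open>card (stab b) - 1\<close> of the factors \<open>u - w u\<close> of the denominator of
  \<open>D u\<close> are divisible by \<open>lin b\<close>, and each of them only once.
\<close>

lemma D_pole_bound:
  assumes b: "b \<noteq> 0"
  shows "regular b (to_fract (lin b ^ (card (stab b) - 1)) * D (to_fract p))"
proof -
  let ?B = "to_fract (lin b ^ (card (stab b) - 1))"
  note prime = prime_elem_lin[OF b]
  \<comment> \<open>For \<open>w\<close> outside the stabiliser \<open>v\<close> is taken on the
    hyperplane: genericity then makes \<open>?u - act w ?u\<close> nonzero at a point of it, hence
    not divisible by \<open>lin b\<close>.\<close>
  define z where "z w = (SOME z. z \<noteq> 0 \<and> (\<exists>v. z = v - matrix_inv w *v v \<and>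
    (w \<notin> stab b \<longrightarrow> poly_eval v (lin b) = 0)))" for w :: "'n cmat"
  have z: "z w \<noteq> 0 \<and> (\<exists>v. z w = v - matrix_inv w *v v \<and> (w \<notin> stab b \<longrightarrow> poly_eval v (lin b) = 0))"
    if w: "w \<in> W - {mat 1}" for w
    unfolding z_def
  proof (rule someI_ex)
    show "\<exists>z. z \<noteq> 0 \<and> (\<exists>v. z = v - matrix_inv w *v v \<and> (w \<notin> stab b \<longrightarrow> poly_eval v (lin b) = 0))"
    proof (cases "w \<in> stab b")
      case True
      then show ?thesis using act_matrix_inv_fixed[of w] w by blast
    next
      case False
      then obtain v where v: "poly_eval v (lin b) = 0" "w *v v \<noteq> v"
        using w by (auto simp: pointwise_stabiliser_def)
      then have "v - matrix_inv w *v v \<noteq> 0"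
        using matrix_inv_cancel(1)[OF invertible_W, of w v] w by auto
      then show ?thesis using v(1) by blast
    qed
  qed
  have "finite (z ` (W - {mat 1}))" using finite_W by simp
  moreover have "0 \<notin> z ` (W - {mat 1})" using z by (metis image_iff)
  ultimately show ?thesis
  proof (induction p rule: mpoly_generic_induct)
    case (Const c)
    then show ?case using regular_to_fract[OF b, of 0] by simp
  next
    case (lin a)
    let ?u = "lin a"
    have "\<exists>f. ?u - act w ?u = f * (if w \<in> stab b then lin b else 1) \<and> \<not> lin b dvd f"
      if w: "w \<in> W - {mat 1}" for w
    proof -
      obtain v where v: "z w = v - matrix_inv w *v v" "w \<notin> stab b \<longrightarrow> poly_eval v (lin b) = 0"
        using z[OF w] by auto
      then have nz: "poly_eval v (?u - act w ?u) \<noteq> 0"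
        using lin[OF imageI[OF w]] by (simp add: poly_eval_lin_vec)
      show ?thesis
      proof (cases "w \<in> stab b")
        case True
        have diff: "?u - act w ?u = lin (a - a v* matrix_inv w)" by (simp add: lin_diff act_lin)
        have "poly_eval x (lin (a - a v* matrix_inv w)) = 0" if "poly_eval x (lin b) = 0" for x
          using stab_fix(2)[OF True that] by (simp flip: diff)
        then obtain c where "a - a v* matrix_inv w = c *s b"
          using lin_proportional[OF b] by metis
        then have c: "?u - act w ?u = Const c * lin b" by (simp add: diff lin_scale)
        then have "c \<noteq> 0" using nz by auto
        then have "\<not> lin b dvd Const c"
          using b by (auto simp: lin_dvd_iff intro: exI[of _ 0] simp: poly_eval_lin)
        with c True show ?thesis by auto
      next
        case False
        then have "\<not> lin b dvd ?u - act w ?u"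
          using v(2) nz lin_dvd_iff[OF b] by blast
        with False show ?thesis by auto
      qed
    qed
    then obtain f where f: "\<And>w. w \<in> W - {mat 1} \<Longrightarrow>
        ?u - act w ?u = f w * (if w \<in> stab b then lin b else 1) \<and> \<not> lin b dvd f w"
      by metis
    have "(\<Prod>w\<in>W - {mat 1}. ?u - act w ?u)
        = (\<Prod>w\<in>W - {mat 1}. f w) * (\<Prod>w\<in>W - {mat 1}. if w \<in> stab b then lin b else 1)"
      using f by (simp add: prod.distrib)
    also have "(\<Prod>w\<in>W - {mat 1}. if w \<in> stab b then lin b else 1) = lin b ^ (card (stab b) - 1)"
    proof -
      have "{w \<in> W - {mat 1}. w \<in> stab b} = stab b - {mat 1}" using stab_subset by auto
      then show ?thesis
        using finite_W finite_stab by (simp add: prod.inter_filter[symmetric] card_Diff_singleton)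
    qed
    finally have denom: "(\<Prod>w\<in>W - {mat 1}. ?u - act w ?u)
        = (\<Prod>w\<in>W - {mat 1}. f w) * lin b ^ (card (stab b) - 1)" .
    obtain g where g: "\<And>w. w \<in> W \<Longrightarrow>
        to_fract (act w (\<Prod>w\<in>W - {mat 1}. ?u - act w ?u)) * D (to_fract (act w ?u)) = to_fract (act w g)"
      using D_clear_denominator by metis
    have "to_fract (\<Prod>w\<in>W - {mat 1}. f w) * (?B * D (to_fract ?u)) = to_fract g"
      using g[OF one_W] by (simp add: denom mult.assoc)
    moreover have "\<not> lin b dvd (\<Prod>w\<in>A. f w)" if "A \<subseteq> W - {mat 1}" for A
      using that
    proof (induction A rule: infinite_finite_induct)
      case (insert w A)
      then show ?case using f[of w] prime_elem_dvd_mult_iff[OF prime] by simp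
    qed (use prime in \<open>simp_all add: prime_elem_def\<close>)
    ultimately show ?case unfolding regular_def by blast
  next
    case (add p q)
    have "?B * D (to_fract (p + q)) = ?B * D (to_fract p) + ?B * D (to_fract q)"
      by (simp add: D_add algebra_simps)
    then show ?case using regular_add[OF b add] by simp
  next
    case (mult p q)
    have "?B * D (to_fract (p * q)) = to_fract p * (?B * D (to_fract q)) + to_fract q * (?B * D (to_fract p))"
      by (simp add: D_mult algebra_simps)
    then show ?case
      using regular_add[OF b regular_mult[OF b regular_to_fract[OF b] mult(2)]
          regular_mult[OF b regular_to_fract[OF b] mult(1)]] by simp
  qed
qed

text \<open>
  If \<open>D p\<close> had a pole of order \<open>l > 0\<close>, every \<open>w\<close> in the stabiliser would act on \<open>lin b\<close> by an
  \<open>l\<close>-th root of unity; these characters are distinct, so \<open>l \<ge> card (stab b)\<close>, contradicting the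
  pole bound.
\<close>

lemma D_regular_if_invariant:
  assumes b: "b \<noteq> 0" and inv: "\<And>w. w \<in> stab b \<Longrightarrow> act w p = p"
  shows "regular b (D (to_fract p))"
proof -
  note prime = prime_elem_lin[OF b]
  define R where "R l \<longleftrightarrow> regular b (to_fract (lin b ^ l) * D (to_fract p))" for l
  define l where "l = (LEAST l. R l)"
  have R: "R (card (stab b) - 1)" unfolding R_def by (rule D_pole_bound[OF b])
  then have "R l" unfolding l_def by (rule LeastI)
  have l_le: "l \<le> card (stab b) - 1" unfolding l_def using R by (rule Least_le)
  show ?thesis
  proof (cases l)
    case 0
    then show ?thesis using \<open>R l\<close> by (simp add: R_def)
  next
    case (Suc l')
    have "\<not> R l'" using Suc not_less_Least[of l' R] by (simp add: l_def)
    obtain c g where c: "\<not> lin b dvd c" and g: "to_fract c * (to_fract (lin b ^ l) * D (to_fract p)) = to_fract g"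
      using \<open>R l\<close> by (auto simp: R_def regular_def)
    \<comment> \<open>Otherwise a factor \<open>lin b\<close> cancels, against the minimality of
      \<open>l\<close>.\<close>
    have "\<not> lin b dvd g"
    proof
      assume "lin b dvd g"
      then obtain h where h: "g = lin b * h" ..
      have "to_fract (lin b) * (to_fract c * (to_fract (lin b ^ l') * D (to_fract p)))
          = to_fract (lin b) * to_fract h"
        using g by (simp add: Suc h algebra_simps)
      then have "to_fract c * (to_fract (lin b ^ l') * D (to_fract p)) = to_fract h"
        using b by simp
      then have "R l'" unfolding R_def regular_def using c by blast
      then show False using \<open>\<not> R l'\<close> by simp
    qed
    have root: "x ^ l = 1" if w: "w \<in> stab b" and x: "act w (lin b) = Const x * lin b" for w x
    proof -
      have "to_fract (act w (c * lin b ^ l)) * D (to_fract (act w p)) = to_fract (act w g)"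
        by (rule D_act[OF stab_W[OF w]]) (use g in \<open>simp add: mult.assoc\<close>)
      then have "to_fract (act w c * (Const x * lin b) ^ l) * D (to_fract p) = to_fract (act w g)"
        by (simp only: inv[OF w] act_mult act_power x)
      then have wg: "to_fract (act w g) = to_fract (act w c * Const x ^ l) * (to_fract (lin b ^ l) * D (to_fract p))"
        by (simp only: power_mult_distrib to_fract_mult mult.assoc)
      have "to_fract (act w g * c)
          = to_fract (act w c * Const x ^ l) * (to_fract c * (to_fract (lin b ^ l) * D (to_fract p)))"
        by (simp only: to_fract_mult wg mult_ac)
      also have "\<dots> = to_fract (act w c * Const x ^ l * g)" by (simp only: g to_fract_mult)
      finally have eq: "act w g * c = act w c * Const x ^ l * g" by (simp only: to_fract_eq_iff)
      \<comment> \<open>On the hyperplane \<open>w\<close> acts trivially, so \<open>act w g\<close>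
        and \<open>act w c\<close> agree there with \<open>g\<close> and \<open>c\<close>, and
        \<open>eq\<close> forces this product to vanish.\<close>
      have "lin b dvd Const (x ^ l - 1) * (c * g)"
        unfolding lin_dvd_iff[OF b]
      proof (intro allI impI)
        fix v assume v: "poly_eval v (lin b) = 0"
        have "poly_eval v (act w g * c) = poly_eval v (act w c * Const x ^ l * g)" using eq by simp
        then show "poly_eval v (Const (x ^ l - 1) * (c * g)) = 0"
          by (simp add: stab_fix(2)[OF w v] algebra_simps)
      qed
      then have "lin b dvd Const (x ^ l - 1)"
        using c \<open>\<not> lin b dvd g\<close> prime_elem_dvd_mult_iff[OF prime] by blast
      \<comment> \<open>\<open>lin b\<close> vanishes at the origin, so a constant divisible by it
        is zero.\<close>
      then have "poly_eval 0 (lin b) = 0 \<longrightarrow> poly_eval 0 (Const (x ^ l - 1) :: 'n mpoly) = 0"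
        unfolding lin_dvd_iff[OF b] by (rule spec)
      then show ?thesis by (simp add: poly_eval_lin)
    qed
    have "\<exists>x. act w (lin b) = Const x * lin b" if "w \<in> stab b" for w
      using act_lin_stab[OF b that] by metis
    then obtain \<mu> where \<mu>: "\<And>w. w \<in> stab b \<Longrightarrow> act w (lin b) = Const (\<mu> w) * lin b" by metis
    have "inj_on \<mu> (stab b)"
    proof (rule inj_onI)
      fix w w' assume w: "w \<in> stab b" "w' \<in> stab b" "\<mu> w = \<mu> w'"
      \<comment> \<open>Equal characters make this quotient fix \<open>lin b\<close>, so it is
        trivial by \<open>stab_fixes_lin\<close>.\<close>
      let ?x = "matrix_inv w ** w'"
      have inv_w: "matrix_inv w \<in> W" using w(1) by (simp add: matrix_inv_W stab_W)
      have "act ?x (lin b) = act (matrix_inv w) (act w' (lin b))"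
        using w inv_w by (simp add: act_act invertible_W stab_W)
      also have "act w' (lin b) = act w (lin b)" using w by (simp add: \<mu>)
      also have "act (matrix_inv w) (act w (lin b)) = act (matrix_inv w ** w) (lin b)"
        using w inv_w by (simp add: act_act invertible_W stab_W)
      also have "\<dots> = lin b" using w by (simp add: matrix_inv_mult_W stab_W)
      finally have "?x = mat 1"
        using stab_fixes_lin[of ?x b] w by (simp add: mult_stab matrix_inv_stab)
      then have "w ** ?x = w" by simp
      then show "w = w'" using w by (simp add: matrix_mul_assoc matrix_inv_mult_W stab_W)
    qed
    then have "card (stab b) = card (\<mu> ` stab b)" by (simp add: card_image)
    also have "\<dots> \<le> card {x :: complex. x ^ l = 1}"
    proof (rule card_mono)
      show "finite {x :: complex. x ^ l = 1}" using Suc by (intro finite_roots_unity) simp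
      show "\<mu> ` stab b \<subseteq> {x. x ^ l = 1}" using root[OF _ \<mu>] by blast
    qed
    also have "\<dots> \<le> l" using Suc by (intro card_roots_unity) simp
    finally show ?thesis using l_le card_stab_pos[of b] by linarith
  qed
qed

text \<open>Differentiating the power of \<open>lin b\<close> costs one factor and the pole of
  \<open>D\<close> at most \<open>card (stab b) - 1\<close> more, which leaves
  \<open>lin b ^ k\<close>.\<close>

lemma D_divisible:
  assumes b: "b \<noteq> 0" and dvd: "lin b ^ (k + card (stab b)) dvd f"
  obtains F where "regular b F" "D (to_fract f) = to_fract (lin b ^ k) * F"
proof -
  let ?n = "card (stab b)" and ?\<beta> = "to_fract (lin b)"
  obtain n where n: "?n = Suc n" using card_stab_pos[of b] by (cases ?n) auto
  obtain x where x: "f = lin b ^ (k + ?n) * x" using dvd ..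
  have to_fract_of_nat: "to_fract (of_nat j :: 'n mpoly) = of_nat j" for j by (induction j) simp_all
  have power: "to_fract (lin b ^ j) = ?\<beta> ^ j" for j by (induction j) simp_all
  have bound: "regular b (?\<beta> ^ n * D (to_fract q))" for q
    using D_pole_bound[OF b, of q] n by (simp add: power)
  \<comment> \<open>The Leibniz rule with \<open>lin b ^ k\<close> taken out. As \<open>n\<close> is
    \<open>card (stab b) - 1\<close>, \<open>bound\<close> makes both bracketed terms
    regular.\<close>
  define F where "F = ?\<beta> * (?\<beta> ^ n * D (to_fract x))
      + to_fract (of_nat (k + ?n) * x) * (?\<beta> ^ n * D ?\<beta>)"
  have "D (to_fract f) = ?\<beta> ^ Suc (k + n) * D (to_fract x) + D (?\<beta> ^ Suc (k + n)) * to_fract x"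
    by (simp only: x n to_fract_mult D_mult power add_Suc_right)
  also have "\<dots> = ?\<beta> ^ k * F"
    unfolding D_power F_def n by (simp add: to_fract_of_nat power_add algebra_simps)
  finally have "D (to_fract f) = to_fract (lin b ^ k) * F" by (simp add: power)
  moreover have "regular b F"
    unfolding F_def
    by (intro regular_add[OF b] regular_mult[OF b _ bound] regular_to_fract[OF b])
  ultimately show ?thesis using that by blast
qed

section \<open>The derivation on quasi-invariants\<close>

lemma D_e_op:
  assumes "D (to_fract p) = to_fract q"
  shows "D (to_fract (e_op W H i p)) = to_fract (e_op W H i q)"
proof -
  have to_fract_sum: "to_fract (sum f A) = (\<Sum>a\<in>A. to_fract (f a))" for f :: "'n cmat \<Rightarrow> 'n mpoly" and A
    by (induction A rule: infinite_finite_induct) simp_all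
  have "D (to_fract (act w p)) = to_fract (act w q)" if "w \<in> pointwise_stabiliser W H" for w
    using D_act_polynomial[OF _ assms] that by (auto simp: pointwise_stabiliser_def)
  then show ?thesis
    by (simp add: e_op_def to_fract_sum D_sum D_Const_mult)
qed

text \<open>For \<open>i = 0\<close> the sum over the stabiliser carries the trivial character, and
  left multiplication only reorders it.\<close>

lemma act_e_op_0:
  assumes "w \<in> stab b"
  shows "act w (e_op W {v. poly_eval v (lin b) = 0} 0 p) = e_op W {v. poly_eval v (lin b) = 0} 0 p"
proof -
  have "act w (e_op W {v. poly_eval v (lin b) = 0} 0 p) = (\<Sum>x\<in>stab b. act (w ** x) p)"
    using assms by (simp add: e_op_def act_simps act_act invertible_W stab_W)
  also have "\<dots> = (\<Sum>x\<in>stab b. act x p)"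
    by (rule sum.reindex_bij_betw[OF bij_betw_stab[OF assms]])
  finally show ?thesis by (simp add: e_op_def)
qed

text \<open>A denominator that is a product of linear forms reduces the claim to regularity at each
  linear form, checked on the components \<open>e_op\<close>. Off the arrangement the stabiliser is
  trivial and only \<open>i = 0\<close> occurs.\<close>

lemma D_quasi_invariant_polynomial:
  assumes forms: "\<forall>H\<in>arrangement W. defining_form H (\<alpha> H)"
    and pos: "\<forall>H\<in>arrangement W. m H \<ge> 1"
    and p: "p \<in> quasi_invariants W \<alpha> m"
  obtains q where "D (to_fract p) = to_fract q"
proof -
  have regular: "regular b (D (to_fract p))" if b: "b \<noteq> 0" for b
  proof -
    let ?n = "card (stab b)" and ?H = "{v. poly_eval v (lin b) = 0}"
    have e: "regular b (D (to_fract (e_op W ?H i p)))" if i: "i < ?n" for i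
    proof (cases "i = 0")
      case True
      then show ?thesis using D_regular_if_invariant[OF b] act_e_op_0 by blast
    next
      case False
      have "\<exists>w\<in>stab b. w \<noteq> mat 1"
      proof (rule ccontr)
        assume "\<not> (\<exists>w\<in>stab b. w \<noteq> mat 1)"
        then have "stab b \<subseteq> {mat 1}" by auto
        then have "?n \<le> 1" using card_mono[of "{mat 1}" "stab b"] by simp
        with i False show False by simp
      qed
      then have H: "?H \<in> arrangement W" using hyperplane_in_arrangement[OF b] by blast
      obtain a where a: "\<alpha> ?H = lin a" "?H = {v. poly_eval v (lin a) = 0}"
        using arrangement_lin[OF H] forms H by metis
      have "lin b dvd \<alpha> ?H" using a lin_dvd_iff[OF b] by auto
      then have "lin b ^ ?n dvd \<alpha> ?H ^ ?n" by (rule dvd_power_same)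
      \<comment> \<open>\<open>m ?H \<ge> 1\<close> provides the \<open>?n\<close> factors that
        \<open>D_divisible\<close> consumes with \<open>k = 0\<close>.\<close>
      also have "\<dots> dvd \<alpha> ?H ^ (m ?H * ?n)" using pos H by (intro le_imp_power_dvd) auto
      also have "\<dots> dvd e_op W ?H i p"
        using p H i False by (auto simp: quasi_invariants_def)
      finally have "lin b ^ (0 + ?n) dvd e_op W ?H i p" by simp
      then obtain F where "regular b F" "D (to_fract (e_op W ?H i p)) = to_fract (lin b ^ 0) * F"
        by (rule D_divisible[OF b])
      then show ?thesis by simp
    qed
    have to_fract_sum: "to_fract (sum f A) = (\<Sum>a\<in>A. to_fract (f a))" for f :: "nat \<Rightarrow> 'n mpoly" and A
      by (induction A rule: infinite_finite_induct) simp_all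
    have "p = Const (1 / of_nat ?n) * (\<Sum>i<?n. e_op W ?H i p)"
      using card_stab_pos[of b] by (simp add: sum_e_op[OF b] mult.assoc[symmetric] flip: Const_mult)
    then have "D (to_fract p) = D (to_fract (Const (1 / of_nat ?n)) * to_fract (\<Sum>i<?n. e_op W ?H i p))"
      by (metis to_fract_mult)
    also have "\<dots> = to_fract (Const (1 / of_nat ?n)) * (\<Sum>i<?n. D (to_fract (e_op W ?H i p)))"
      by (simp only: D_Const_mult to_fract_sum D_sum)
    finally show ?thesis
      using regular_mult[OF b regular_to_fract[OF b] regular_sum[OF b, of "{..<?n}"]] e by simp
  qed
  obtain c g where c: "lin_product c"
    and g: "\<forall>w\<in>W. to_fract (act w c) * D (to_fract (act w p)) = to_fract (act w g)"
    using D_lin_product_denominator by blast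
  have "to_fract c * D (to_fract p) = to_fract g" using bspec[OF g one_W] by simp
  then show ?thesis using polynomial_if_regular[OF c _ regular] that by blast
qed

text \<open>As \<open>D p\<close> is a polynomial and \<open>D\<close> commutes with
  \<open>e_op\<close>, \<open>D_divisible\<close> turns the exponent \<open>m H * ?n\<close> into
  \<open>(m H - 1) * ?n\<close>; primality of the form then removes the remaining
  denominator.\<close>

theorem D_quasi_invariants:
  assumes forms: "\<forall>H\<in>arrangement W. defining_form H (\<alpha> H)"
    and pos: "\<forall>H\<in>arrangement W. m H \<ge> 1"
  shows "D ` to_fract ` quasi_invariants W \<alpha> m
    \<subseteq> to_fract ` quasi_invariants W \<alpha> (\<lambda>H. m H - 1)"
proof
  fix F assume "F \<in> D ` to_fract ` quasi_invariants W \<alpha> m"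
  then obtain p where p: "p \<in> quasi_invariants W \<alpha> m" and F: "F = D (to_fract p)" by auto
  obtain q where q: "D (to_fract p) = to_fract q"
    using D_quasi_invariant_polynomial[OF forms pos p] .
  have "\<alpha> H ^ ((m H - 1) * card (pointwise_stabiliser W H)) dvd e_op W H i q"
    if H: "H \<in> arrangement W" and i: "i \<in> {1..card (pointwise_stabiliser W H) - 1}" for H i
  proof -
    obtain a where a: "\<alpha> H = lin a" "a \<noteq> 0" "H = {v. poly_eval v (lin a) = 0}"
      using arrangement_lin[OF H] forms H by metis
    let ?n = "card (stab a)"
    have "m H \<ge> 1" using pos H by blast
    \<comment> \<open>\<open>m H \<ge> 1\<close> keeps the truncated subtraction exact.\<close>
    then have "(m H - 1) * ?n + ?n = m H * ?n" by (cases "m H") simp_all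
    moreover have "lin a ^ (m H * ?n) dvd e_op W H i p"
      using p H i a(1,3) by (auto simp: quasi_invariants_def)
    ultimately have "lin a ^ ((m H - 1) * ?n + ?n) dvd e_op W H i p" by simp
    then obtain G where G: "regular a G"
      and DG: "D (to_fract (e_op W H i p)) = to_fract (lin a ^ ((m H - 1) * ?n)) * G"
      by (rule D_divisible[OF a(2)])
    obtain c g where c: "\<not> lin a dvd c" and g: "to_fract c * G = to_fract g"
      using G by (auto simp: regular_def)
    have "to_fract (c * e_op W H i q) = to_fract (lin a ^ ((m H - 1) * ?n)) * (to_fract c * G)"
      by (simp only: to_fract_mult D_e_op[OF q, symmetric] DG mult_ac)
    also have "\<dots> = to_fract (lin a ^ ((m H - 1) * ?n) * g)" by (simp only: g to_fract_mult)
    finally have "c * e_op W H i q = lin a ^ ((m H - 1) * ?n) * g" by (simp only: to_fract_eq_iff)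
    then have "lin a ^ ((m H - 1) * ?n) dvd e_op W H i q"
      using prime_elem_power_dvd_cancel[OF prime_elem_lin[OF a(2)] c] by (metis dvd_triv_left)
    then show ?thesis using a(1,3) by simp
  qed
  then have "q \<in> quasi_invariants W \<alpha> (\<lambda>H. m H - 1)" by (simp add: quasi_invariants_def)
  then show "F \<in> to_fract ` quasi_invariants W \<alpha> (\<lambda>H. m H - 1)" using q F by simp
qed

end

section \<open>The primitive derivation preserves the invariants\<close>

lemma invariant_derivationI:
  fixes W :: "'n::{finite,linorder} cmat set"
  assumes "finite W" "subgroup W GL" "basic_invariants W y" "primitive_derivation y D"
  shows "invariant_derivation W D"
proof -
  interpret matrix_group W using assms(1,2) by (rule matrix_group.intro)
  have der: "derivation D" and Dy: "\<And>i. D (to_fract (y i)) = (if i = Max UNIV then 1 else 0)"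
    using assms(4) by (auto simp: primitive_derivation_def)
  have add: "D (a + b) = D a + D b" and mult: "D (a * b) = a * D b + D a * b"
    and scale: "D (to_fract (Const c) * a) = to_fract (Const c) * D a" for a b c
    using der by (auto simp: derivation_def)
  have y: "y i \<in> invariants W" for i using assms(3) by (auto simp: basic_invariants_def)
  have D1: "D 1 = 0" using mult[of 1 1] by (metis add_cancel_right_right mult_1 mult_1_right)
  \<comment> \<open>\<open>D\<close> sends each basic invariant to 0 or 1, so by the Leibniz rule it
    sends polynomials in them to invariant polynomials.\<close>
  have subst: "poly_subst y P \<in> invariants W \<and> D (to_fract (poly_subst y P)) \<in> to_fract ` invariants W" for P
  proof (induction P rule: mpoly_ring_induct)
    case (Const c)
    have "D (to_fract (Const c)) = to_fract (Const 0)" using scale[of c 1] D1 by simp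
    then show ?case by (auto intro!: imageI simp del: Const_0)
  next
    case (Var i)
    have "D (to_fract (y i)) = to_fract (Const (if i = Max UNIV then 1 else 0))" by (simp add: Dy)
    then show ?case using y by (auto intro!: imageI simp del: Const_0 Const_1)
  next
    case (add p q)
    then obtain p' q' where "p' \<in> invariants W" "D (to_fract (poly_subst y p)) = to_fract p'"
      "q' \<in> invariants W" "D (to_fract (poly_subst y q)) = to_fract q'" by blast
    moreover from this have "D (to_fract (poly_subst y (p + q))) = to_fract (p' + q')"
      by (simp add: poly_subst_add \<open>\<And>a b. D (a + b) = D a + D b\<close>)
    ultimately show ?case using add by (auto simp: poly_subst_add intro!: invariants_add imageI simp del: to_fract_add)
  next
    case (mult p q)
    then obtain p' q' where "p' \<in> invariants W" "D (to_fract (poly_subst y p)) = to_fract p'"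
      "q' \<in> invariants W" "D (to_fract (poly_subst y q)) = to_fract q'" by blast
    moreover from this have "D (to_fract (poly_subst y (p * q)))
        = to_fract (poly_subst y p * q' + p' * poly_subst y q)"
      by (simp add: poly_subst_mult \<open>\<And>a b. D (a * b) = a * D b + D a * b\<close>)
    ultimately show ?case using mult
      by (auto simp: poly_subst_mult intro!: invariants_add invariants_mult imageI
          simp del: to_fract_add to_fract_mult)
  qed
  show ?thesis
  proof
    show "D (to_fract f) \<in> to_fract ` invariants W" if f: "f \<in> invariants W" for f
    proof -
      obtain P where "f = poly_subst y P" using f assms(3) unfolding basic_invariants_def by blast
      then show ?thesis using subst by simp
    qed
  qed (rule der)
qed

theorem proposition4p1:
  fixes W :: "'n::{finite,linorder} cmat set"
    and \<alpha> :: "'n cvec set \<Rightarrow> 'n mpoly"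
    and m :: "'n cvec set \<Rightarrow> nat"
    and y :: "'n \<Rightarrow> 'n mpoly"
    and D :: "'n mpoly fract \<Rightarrow> 'n mpoly fract"
  assumes "finite_complex_reflection_group W"
    and "irreducible_action W"
    and "\<forall>H\<in>arrangement W. defining_form H (\<alpha> H)"
    and "\<forall>w\<in>W. \<forall>H\<in>arrangement W. m ((*v) w ` H) = m H"
    and "\<forall>H\<in>arrangement W. m H \<ge> 1"
    and "basic_invariants W y"
    and "primitive_derivation y D"
  shows "D ` to_fract ` quasi_invariants W \<alpha> m
           \<subseteq> to_fract ` quasi_invariants W \<alpha> (\<lambda>H. m H - 1)"
proof -
  have "finite W" "subgroup W GL"
    using assms(1) by (auto simp: finite_complex_reflection_group_def)
  then interpret invariant_derivation W D
    using assms(6,7) by (rule invariant_derivationI)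
  show ?thesis using assms(3,5) by (rule D_quasi_invariants)
qed

end
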